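(* For every integer $n\ge1$, the $\mathrm{BZ}'_+$-rank of $MT(K_{2n+1})$ is at most $\left\lceil\sqrt{2n+\frac14}-\frac12\right\rceil$.
   Context: **Notation.** Let $d\ge 1$, $[d]=\{1,\dots,d\}$, $\mathcal F=\{0,1\}^d$, and let $\mathcal A=2^{\mathcal F}$ be the power set of $\mathcal F$. For $P\subseteq[0,1]^d$ let $P_I=\mathrm{conv}(P\cap\{0,1\}^d)$ and $K(P)=\{(\lambda,\lambda x)\in\mathbb R^{d+1}:\lambda\ge 0,\ x\in P\}$. For $S\subseteq[d]$, $t\in\{0,1\}$, let $S|_t=\{x\in\mathcal F: x_i=t\ \forall i\in S\}$ (so $\emptyset|_t=\mathcal F$) and $i|_t=\{i\}|_t$. For $U\subseteq[d]$ and an integer $r\ge0$ let $U|_{<r}=\{x\in\mathcal F:\sum_{i\in U}x_i\le r-1\}$. Matrices have rows and columns indexed by subfamilies of $\mathcal A$; $Ye_\alpha$ is the column of $Y$ indexed by $\alpha$. For a vector $y$ indexed by a family containing $\mathcal F$ and all $i|_1$, $\hat x(y)=(y_{\mathcal F},y_{1|_1},\dots,y_{d|_1})^\top$; for $x\in\mathbb R^d$, $\hat x=(1,x)\in\mathbb R^{d+1}$. **The operator $\mathrm{BZ}_+'^k$ ($k\ge1$).** The input is $P=\{x\in[0,1]^d:Ax\le b\}$ with $A\in\mathbb R^{m\times d}$ nonnegative and $b\in\mathbb R^m$ positive; the operator depends on the system $Ax\le b$. Let $A^i$ be the $i$-th row of $A$. A set $O\subseteq[d]$ is a $k$-small obstruction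 if for some $i\in[m]$: $O\subseteq\mathrm{supp}(A^i)$, $\sum_{j\in O}A^i_j>b_i$, and ($|O|\le k+1$ or $|O|\ge|\mathrm{supp}(A^i)|-(k+1)$). Let $\mathcal O_k$ be the collection of all $k$-small obstructions and $\mathcal O_k(P)=\{x\in P:\sum_{i\in O}x_i\le|O|-1\ \forall O\in\mathcal O_k\}$. Walls: $\mathcal W_k=\{\bigcup_{i,j\in[\ell],i\ne j}(O_i\cap O_j):O_1,\dots,O_\ell\in\mathcal O_k,\ 2\le\ell\le k+1\}\cup\{\{1\},\dots,\{d\}\}$. Tiers: $\mathcal T_k=\{S\subseteq[d]:\exists W_1,\dots,W_k\in\mathcal W_k,\ S\subseteq\bigcup_{j=1}^kW_j\}$. Let $\mathcal A'$ consist of, for each tier $S\in\mathcal T_k$: (a) $(S\setminus T)|_1\cap T|_0$ for all $T\subseteq S$ with $|T|\le k$; (b) $(S\setminus(T\cup U))|_1\cap T|_0\cap U|_{<|U|-(k-|T|)}$ for all $T,U\subseteq S$ with $U\cap T=\emptyset$, $|T|<k$, $|U|+|T|>k$. Let $\tilde{\mathrm{BZ}}_+'^k(P)$ be the set of symmetric positive semidefinite real matrices $Y$ indexed by $\mathcal A'\times\mathcal A'$ such that: (BZ'1) $Y[\mathcal F,\mathcal F]=1$. (BZ'2) Every column $y$ of $Y$ satisfies: (i) $0\le y_\alpha\le y_{\mathcal F}$ for all $\alpha\in\mathcal A'$; (ii) $\hat x(y)\in K(\mathcal O_k(P))$; (iii) $y_{i|_1}+y_{i|_0}=y_{\mathcal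 F}$ for all $i\in[d]$; (iv) for each $\alpha\in\mathcal A'$ of the form $S|_1\cap T|_0$: $y_{i|_1}\ge y_\alpha$ for $i\in S$; $y_{i|_0}\ge y_\alpha$ for $i\in T$; $y_\alpha+y_{(S\cup\{i\})|_1\cap(T\setminus\{i\})|_0}=y_{S|_1\cap(T\setminus\{i\})|_0}$ for $i\in T$; $\sum_{i\in S}y_{i|_1}+\sum_{i\in T}y_{i|_0}-y_\alpha\le(|S|+|T|-1)y_{\mathcal F}$; (v) for each $\alpha\in\mathcal A'$ of the form $S|_1\cap T|_0\cap U|_{<r}$: $y_{i|_1}\ge y_\alpha$ for $i\in S$; $y_{i|_0}\ge y_\alpha$ for $i\in T$; $\sum_{i\in U}y_{i|_0}\ge(|U|-(r-1))y_\alpha$; $y_\alpha=y_{S|_1\cap T|_0}-\sum_{U'\subseteq U,|U'|\ge r}y_{(S\cup U')|_1\cap(T\cup(U\setminus U'))|_0}$. (BZ'3) $Y[\alpha,\beta]=0$ for all $\alpha,\beta\in\mathcal A'$ with $\mathrm{conv}(\alpha)\cap\mathrm{conv}(\beta)\cap P=\emptyset$. (BZ'4) $Y[\alpha_1,\beta_1]=Y[\alpha_2,\beta_2]$ whenever $\alpha_1,\beta_1,\alpha_2,\beta_2\in\mathcal A'$ and $\alpha_1\cap\beta_1=\alpha_2\cap\beta_2$. Then $\mathrm{BZ}_+'^k(P)=\{x\in\mathbb R^d:\exists Y\in\tilde{\mathrm{BZ}}_+'^k(P),\ \hat x(Ye_{\mathcal F})=\hat x\}$. **Rank.** For an operator $\Gamma$,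 the $\Gamma$-rank of $P$ is the smallest integer $k\ge 0$ with $\Gamma^k(P)=P_I$, where $\Gamma^0(P)=P$. **Matching relaxation.** For a simple undirected graph $G=(V,E)$, $MT(G)=\{x\in[0,1]^E:\sum_{j:\{i,j\}\in E}x_{ij}\le1\ \forall i\in V\}$, given by this system of inequalities (one row for each vertex); coordinates are indexed by $E$ (so $[d]$ is identified with $E$). $K_m$ is the complete graph on $m$ vertices. *)

theory Defs
  imports "HOL-Analysis.Analysis" "HOL-Library.Function_Algebras" "HOL-Library.Extended_Nat"
begin

(* Pointwise scalar multiplication, so that the library's "convex hull" is available for
   real vectors represented as functions on their coordinates. *)

instantiation "fun" :: (type, real_vector) real_vector
begin

definition scaleR_fun :: "real \<Rightarrow> ('a \<Rightarrow> 'b) \<Rightarrow> 'a \<Rightarrow> 'b"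
  where "scaleR_fun c f = (\<lambda>x. c *\<^sub>R f x)"

instance
  by standard (simp_all add: scaleR_fun_def fun_eq_iff scaleR_add_right scaleR_add_left)

end

(* A system A x \<le> b with coordinate set [d] replaced by a finite set of columns.  A vector
   indexed by the columns is a function that vanishes outside them. *)

record ('r, 'c) lin_system =
  rows :: "'r set"
  cols :: "'c set"
  coeff :: "'r \<Rightarrow> 'c \<Rightarrow> real"
  rhs :: "'r \<Rightarrow> real"

(* The class of inputs for which the operator bz_plus below is meant. *)
definition packing_system :: "('r, 'c) lin_system \<Rightarrow> bool"
  where "packing_system L \<longleftrightarrow> finite (rows L) \<and> finite (cols L) \<and>
    (\<forall>i\<in>rows L. rhs L i > 0 \<and> (\<forall>j\<in>cols L. coeff L i j \<ge> 0))"

definition unit_cube :: "'c set \<Rightarrow> ('c \<Rightarrow> real) set"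
  where "unit_cube C = {x. (\<forall>i\<in>C. 0 \<le> x i \<and> x i \<le> 1) \<and> (\<forall>i. i \<notin> C \<longrightarrow> x i = 0)}"

definition zero_one :: "'c set \<Rightarrow> ('c \<Rightarrow> real) set"
  where "zero_one C = {x. (\<forall>i\<in>C. x i = 0 \<or> x i = 1) \<and> (\<forall>i. i \<notin> C \<longrightarrow> x i = 0)}"

definition polytope_of :: "('r, 'c) lin_system \<Rightarrow> ('c \<Rightarrow> real) set"
  where "polytope_of L =
    {x \<in> unit_cube (cols L). \<forall>i\<in>rows L. (\<Sum>j\<in>cols L. coeff L i j * x j) \<le> rhs L i}"

definition integer_hull :: "'c set \<Rightarrow> ('c \<Rightarrow> real) set \<Rightarrow> ('c \<Rightarrow> real) set"
  where "integer_hull C P = convex hull (P \<inter> zero_one C)"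

definition homog_cone :: "('c \<Rightarrow> real) set \<Rightarrow> (real \<times> ('c \<Rightarrow> real)) set"
  where "homog_cone P = {(l, l *\<^sub>R x) | l x. 0 \<le> l \<and> x \<in> P}"

(* S|_t for t = 0, 1 *)
definition fix_at :: "'c set \<Rightarrow> 'c set \<Rightarrow> real \<Rightarrow> ('c \<Rightarrow> real) set"
  where "fix_at C S t = {x \<in> zero_one C. \<forall>i\<in>S. x i = t}"

(* U|_{<r} *)
definition fewer_than :: "'c set \<Rightarrow> 'c set \<Rightarrow> nat \<Rightarrow> ('c \<Rightarrow> real) set"
  where "fewer_than C U r = {x \<in> zero_one C. (\<Sum>i\<in>U. x i) \<le> real r - 1}"

definition row_support :: "('r, 'c) lin_system \<Rightarrow> 'r \<Rightarrow> 'c set"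
  where "row_support L i = {j \<in> cols L. coeff L i j \<noteq> 0}"

definition small_obstructions :: "('r, 'c) lin_system \<Rightarrow> nat \<Rightarrow> 'c set set"
  where "small_obstructions L k =
    {Q. \<exists>i\<in>rows L. Q \<subseteq> row_support L i \<and> (\<Sum>j\<in>Q. coeff L i j) > rhs L i \<and>
         (card Q \<le> k + 1 \<or> int (card Q) \<ge> int (card (row_support L i)) - int (k + 1))}"

definition obstruction_relax :: "('r, 'c) lin_system \<Rightarrow> nat \<Rightarrow> ('c \<Rightarrow> real) set"
  where "obstruction_relax L k =
    {x \<in> polytope_of L. \<forall>Q\<in>small_obstructions L k. (\<Sum>i\<in>Q. x i) \<le> real (card Q) - 1}"

(* The obstructions generating a wall need not be distinct. *)
definition walls :: "('r, 'c) lin_system \<Rightarrow> nat \<Rightarrow> 'c set set"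
  where "walls L k =
    {(\<Union>i\<in>{1..l}. \<Union>j\<in>{1..l} - {i}. Q i \<inter> Q j) | (l :: nat) Q.
        2 \<le> l \<and> l \<le> k + 1 \<and> (\<forall>i\<in>{1..l}. Q i \<in> small_obstructions L k)}
    \<union> {{i} | i. i \<in> cols L}"

definition tiers :: "('r, 'c) lin_system \<Rightarrow> nat \<Rightarrow> 'c set set"
  where "tiers L k =
    {S. S \<subseteq> cols L \<and>
        (\<exists>W. (\<forall>j\<in>{1..k}. W j \<in> walls L k) \<and> S \<subseteq> (\<Union>j\<in>{1..k}. W j))}"

(* In the second family the natural-number subtractions do not truncate, and the threshold
   is at least 1. *)
definition bz_index :: "('r, 'c) lin_system \<Rightarrow> nat \<Rightarrow> ('c \<Rightarrow> real) set set"
  where "bz_index L k =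
    {fix_at (cols L) (S - T) 1 \<inter> fix_at (cols L) T 0 | S T.
        S \<in> tiers L k \<and> T \<subseteq> S \<and> card T \<le> k}
    \<union>
    {fix_at (cols L) (S - (T \<union> U)) 1 \<inter> fix_at (cols L) T 0
        \<inter> fewer_than (cols L) U (card U - (k - card T)) | S T U.
        S \<in> tiers L k \<and> T \<subseteq> S \<and> U \<subseteq> S \<and> U \<inter> T = {} \<and>
        card T < k \<and> card U + card T > k}"

(* Vectors indexed by bz_index and matrices indexed by bz_index x bz_index are total
   functions of which only the entries on these index sets matter. *)

definition sym_on :: "'i set \<Rightarrow> ('i \<Rightarrow> 'i \<Rightarrow> real) \<Rightarrow> bool"
  where "sym_on N Y \<longleftrightarrow> (\<forall>\<alpha>\<in>N. \<forall>\<beta>\<in>N. Y \<alpha> \<beta> = Y \<beta> \<alpha>)"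

definition psd_on :: "'i set \<Rightarrow> ('i \<Rightarrow> 'i \<Rightarrow> real) \<Rightarrow> bool"
  where "psd_on N Y \<longleftrightarrow> (\<forall>c. 0 \<le> (\<Sum>\<alpha>\<in>N. \<Sum>\<beta>\<in>N. c \<alpha> * Y \<alpha> \<beta> * c \<beta>))"

definition hat :: "('c \<Rightarrow> real) \<Rightarrow> real \<times> ('c \<Rightarrow> real)"
  where "hat x = (1, x)"

definition hat_col :: "'c set \<Rightarrow> (('c \<Rightarrow> real) set \<Rightarrow> real) \<Rightarrow> real \<times> ('c \<Rightarrow> real)"
  where "hat_col C y = (y (zero_one C), \<lambda>i. if i \<in> C then y (fix_at C {i} 1) else 0)"

(* The conditions on a column y at an index of the form S|_1 \<inter> T|_0. *)
definition column_cond2 ::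
  "'c set \<Rightarrow> (('c \<Rightarrow> real) set \<Rightarrow> real) \<Rightarrow> 'c set \<Rightarrow> 'c set \<Rightarrow> bool"
  where "column_cond2 C y S T \<longleftrightarrow>
    (let v = (\<lambda>S T. y (fix_at C S 1 \<inter> fix_at C T 0)) in
      (\<forall>i\<in>S. y (fix_at C {i} 1) \<ge> v S T) \<and>
      (\<forall>i\<in>T. y (fix_at C {i} 0) \<ge> v S T) \<and>
      (\<forall>i\<in>T. v S T + v (S \<union> {i}) (T - {i}) = v S (T - {i})) \<and>
      (\<Sum>i\<in>S. y (fix_at C {i} 1)) + (\<Sum>i\<in>T. y (fix_at C {i} 0)) - v S T
        \<le> (real (card S) + real (card T) - 1) * y (zero_one C))"

(* The conditions on a column y at an index of the form S|_1 \<inter> T|_0 \<inter> U|_{<r}. *)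
definition column_cond3 ::
  "'c set \<Rightarrow> (('c \<Rightarrow> real) set \<Rightarrow> real) \<Rightarrow> 'c set \<Rightarrow> 'c set \<Rightarrow> 'c set \<Rightarrow> nat \<Rightarrow> bool"
  where "column_cond3 C y S T U r \<longleftrightarrow>
    (let v = (\<lambda>S T. y (fix_at C S 1 \<inter> fix_at C T 0));
         a = y (fix_at C S 1 \<inter> fix_at C T 0 \<inter> fewer_than C U r) in
      (\<forall>i\<in>S. y (fix_at C {i} 1) \<ge> a) \<and>
      (\<forall>i\<in>T. y (fix_at C {i} 0) \<ge> a) \<and>
      (\<Sum>i\<in>U. y (fix_at C {i} 0)) \<ge> (real (card U) - (real r - 1)) * a \<and>
      a = v S T - (\<Sum>U'\<in>{U'. U' \<subseteq> U \<and> card U' \<ge> r}. v (S \<union> U') (T \<union> (U - U'))))"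

(* Every member of bz_index is nonempty, so S and T are automatically disjoint in the
   S|_1 \<inter> T|_0 clause.  In the S|_1 \<inter> T|_0 \<inter> U|_{<r} clause S, T, U are required
   to be pairwise disjoint, as in bz_index: otherwise the sum in column_cond3 would mention
   entries at the empty set, which is not an index. *)
definition column_cond ::
  "('r, 'c) lin_system \<Rightarrow> nat \<Rightarrow> (('c \<Rightarrow> real) set \<Rightarrow> real) \<Rightarrow> bool"
  where "column_cond L k y \<longleftrightarrow>
    (\<forall>\<alpha>\<in>bz_index L k. 0 \<le> y \<alpha> \<and> y \<alpha> \<le> y (zero_one (cols L))) \<and>
    hat_col (cols L) y \<in> homog_cone (obstruction_relax L k) \<and>
    (\<forall>i\<in>cols L. y (fix_at (cols L) {i} 1) + y (fix_at (cols L) {i} 0) = y (zero_one (cols L))) \<and>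
    (\<forall>S T. S \<subseteq> cols L \<longrightarrow> T \<subseteq> cols L \<longrightarrow>
        fix_at (cols L) S 1 \<inter> fix_at (cols L) T 0 \<in> bz_index L k \<longrightarrow>
        column_cond2 (cols L) y S T) \<and>
    (\<forall>S T U r. S \<subseteq> cols L \<longrightarrow> T \<subseteq> cols L \<longrightarrow> U \<subseteq> cols L \<longrightarrow>
        S \<inter> T = {} \<longrightarrow> S \<inter> U = {} \<longrightarrow> T \<inter> U = {} \<longrightarrow>
        fix_at (cols L) S 1 \<inter> fix_at (cols L) T 0 \<inter> fewer_than (cols L) U r \<in> bz_index L k \<longrightarrow>
        column_cond3 (cols L) y S T U r)"

definition bz_matrices ::
  "('r, 'c) lin_system \<Rightarrow> nat \<Rightarrow> (('c \<Rightarrow> real) set \<Rightarrow> ('c \<Rightarrow> real) set \<Rightarrow> real) set"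
  where "bz_matrices L k =
    {Y. sym_on (bz_index L k) Y \<and> psd_on (bz_index L k) Y \<and>
        Y (zero_one (cols L)) (zero_one (cols L)) = 1 \<and>
        (\<forall>\<beta>\<in>bz_index L k. column_cond L k (\<lambda>\<alpha>. Y \<alpha> \<beta>)) \<and>
        (\<forall>\<alpha>\<in>bz_index L k. \<forall>\<beta>\<in>bz_index L k.
            convex hull \<alpha> \<inter> convex hull \<beta> \<inter> polytope_of L = {} \<longrightarrow> Y \<alpha> \<beta> = 0) \<and>
        (\<forall>\<alpha>1\<in>bz_index L k. \<forall>\<beta>1\<in>bz_index L k. \<forall>\<alpha>2\<in>bz_index L k. \<forall>\<beta>2\<in>bz_index L k.
            \<alpha>1 \<inter> \<beta>1 = \<alpha>2 \<inter> \<beta>2 \<longrightarrow> Y \<alpha>1 \<beta>1 = Y \<alpha>2 \<beta>2)}"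

definition bz_plus :: "nat \<Rightarrow> ('r, 'c) lin_system \<Rightarrow> ('c \<Rightarrow> real) set"
  where "bz_plus k L =
    {x. \<exists>Y\<in>bz_matrices L k. hat_col (cols L) (\<lambda>\<alpha>. Y \<alpha> (zero_one (cols L))) = hat x}"

(* The rank of an operator G, which may depend on the system and not only on its polytope.
   Level 0 is the polytope itself whatever G 0 is; the rank is infinite if no level gives
   the integer hull. *)
definition op_rank ::
  "(nat \<Rightarrow> ('r, 'c) lin_system \<Rightarrow> ('c \<Rightarrow> real) set) \<Rightarrow> ('r, 'c) lin_system \<Rightarrow> enat"
  where "op_rank G L =
    Inf {enat k | k. (if k = 0 then polytope_of L else G k L)
                       = integer_hull (cols L) (polytope_of L)}"

(* A simple graph is given by a vertex set V and a set E of two-element subsets of V. *)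

definition complete_edges :: "'v set \<Rightarrow> 'v set set"
  where "complete_edges V = {e. e \<subseteq> V \<and> card e = 2}"

definition MT :: "'v set \<Rightarrow> 'v set set \<Rightarrow> ('v, 'v set) lin_system"
  where "MT V E =
    \<lparr> rows = V, cols = E, coeff = (\<lambda>i e. if i \<in> e then 1 else 0), rhs = (\<lambda>_. 1) \<rparr>"

lemma packing_system_MT:
  assumes "finite V" and "E \<subseteq> complete_edges V"
  shows "packing_system (MT V E)"
proof -
  have "E \<subseteq> Pow V" using assms(2) by (auto simp: complete_edges_def)
  then show ?thesis using assms(1) finite_subset[of E "Pow V"]
    by (auto simp: packing_system_def MT_def)
qed

end

theory Submission
  imports Defs "HOL-Computational_Algebra.Fundamental_Theorem_Algebra"
begin

text \<open>Let \<open>t = k * ((k + 1) div 2)\<close>. A wall may repeat an obstruction, so it can contain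
  \<open>(k + 1) div 2\<close> full stars, and hence every set of at most \<open>t\<close> edges is a tier. The entries of \<open>Y\<close>
  at the corresponding indices form a moment matrix that controls all edge sets of size up to \<open>2 * t\<close>,
  and sets that are not matchings get moment 0. Fix an odd vertex set of size \<open>2 * m + 1\<close> with
  \<open>m \<le> n \<le> k * (k + 1) / 2\<close>, and let \<open>X\<close> be the number of matching edges inside it, so that
  \<open>i = m - X\<close> takes values in \<open>{0..m}\<close>. For odd \<open>N \<in> {m, m + 1}\<close> the polynomial
  \<open>i * (1 - (\<Prod>l = 1..N. 1 - i / l))\<close> agrees with \<open>i\<close> on these values, is nonnegative on the reals and
  thus a sum of squares, and has degree \<open>N + 1 \<le> 2 * t\<close>. Positive semidefiniteness therefore gives the
  blossom inequality \<open>X \<le> m\<close>, and Edmonds' theorem shows that the blossom inequalities, together with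
  the constraints of the relaxation, describe the integer hull.\<close>

section \<open>Separation from a finite set of vectors\<close>

text \<open>Positive semidefiniteness tests only squares of polynomials of degree at most
  \<open>t\<close>, and the slack \<open>m - X\<close> is not such a square. Only its values at the
  sizes of matchings matter, though, so any globally nonnegative interpolant of degree at most
  \<open>2 * t\<close> can stand in for it. An odd number of factors gives the product the right
  sign beyond its roots; hence the choice between \<open>m\<close> and \<open>m + 1\<close>. Since
  \<open>k * k \<le> 2 * t\<close>, there is room to spare for \<open>k \<ge> 3\<close>, but
  \<open>k = 1\<close> and \<open>k = 2\<close> are tight: there \<open>m = 1\<close> and
  \<open>m = 3\<close> fit only because they are odd. Moments of edge sets with more than
  \<open>2 * t\<close> elements are not determined by \<open>Y\<close>, so no probability
  distribution on matchings is at hand; a signed weight takes its place. The bound on the rank is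
  the least \<open>k\<close> with \<open>2 * n \<le> k * (k + 1)\<close>, because
  \<open>sqrt (2 * n + 1 / 4) - 1 / 2\<close> solves \<open>x * (x + 1) = 2 * n\<close>. The rank
  asks for equality with the integer hull, so the reverse inclusion is proved too, for every packing
  system.\<close>

lemma convex_hull_separation:
  fixes Z :: "('c \<Rightarrow> real) set"
  assumes fin: "finite C" "finite Z" "Z \<noteq> {}"
    and Z0: "\<And>z i. z \<in> Z \<Longrightarrow> i \<notin> C \<Longrightarrow> z i = 0"
    and x0: "\<And>i. i \<notin> C \<Longrightarrow> x i = 0"
    and nx: "x \<notin> convex hull Z"
  shows "\<exists>w. \<forall>z\<in>Z. (\<Sum>i\<in>C. w i * z i) < (\<Sum>i\<in>C. w i * x i)"
proof -
  \<comment> \<open>Coefficient vectors are functions on the whole type, pinned to 0 off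
    \<open>Z\<close>, so that compactness is Tychonoff's theorem; the distance to \<open>x\<close>
    is minimised over them.\<close>
  define B where "B = (\<Pi>\<^sub>E z\<in>UNIV. if z \<in> Z then {0..1::real} else {0})"
  define D where "D = B \<inter> {l. (\<Sum>z\<in>Z. l z) = 1}"
  define d where "d = (\<lambda>l. \<Sum>i\<in>C. (x i - (\<Sum>z\<in>Z. l z * z i))^2)"
  have cB: "compact B"
    unfolding B_def
    by (subst compactin_euclidean_iff [symmetric], subst euclidean_product_topology [symmetric],
        subst compactin_PiE) auto
  have "closed {l :: ('c \<Rightarrow> real) \<Rightarrow> real. (\<Sum>z\<in>Z. l z) = 1}"
    by (intro closed_Collect_eq continuous_intros continuous_on_product_coordinates)
  then have cD: "compact D" unfolding D_def using cB by (rule compact_Int_closed[rotated])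
  obtain z0 where z0: "z0 \<in> Z" using fin by auto
  have "(\<lambda>z. if z = z0 then 1 else 0) \<in> D"
    using z0 fin by (simp add: D_def B_def PiE_def Pi_def)
  then have Dne: "D \<noteq> {}" by auto
  have cont: "continuous_on D d"
    unfolding d_def by (intro continuous_intros continuous_on_product_coordinates
        continuous_on_subset[OF continuous_on_product_coordinates])
      auto
  obtain l where l: "l \<in> D" and lmin: "\<And>l'. l' \<in> D \<Longrightarrow> d l \<le> d l'"
    using continuous_attains_inf[OF cD Dne cont] by blast
  define p where "p = (\<lambda>i. \<Sum>z\<in>Z. l z * z i)"
  define w where "w = (\<lambda>i. x i - p i)"
  have l01: "0 \<le> l z" "l z \<le> 1" if "z \<in> Z" for z
    using l that unfolding D_def B_def PiE_def Pi_def by (auto split: if_splits)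
  have lz: "l z = 0" if "z \<notin> Z" for z
  proof -
    have "l z \<in> (if z \<in> Z then {0..1::real} else {0})"
      using l unfolding D_def B_def by (blast dest: PiE_mem)
    then show ?thesis using that by simp
  qed
  have lsum: "(\<Sum>z\<in>Z. l z) = 1" using l by (auto simp: D_def)
  \<comment> \<open>\<open>p\<close> is the nearest point of the hull: if \<open>z\<close> made an
    acute angle with \<open>w\<close> at \<open>p\<close>, a short step from \<open>p\<close>
    towards \<open>z\<close> would come closer to \<open>x\<close>.\<close>
  have obtuse: "(\<Sum>i\<in>C. w i * (z i - p i)) \<le> 0" if z: "z \<in> Z" for z
  proof (rule ccontr)
    define a where "a = (\<Sum>i\<in>C. w i * (z i - p i))"
    define b where "b = (\<Sum>i\<in>C. (z i - p i)^2)"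
    assume "\<not> ?thesis"
    then have a: "a > 0" by (simp add: a_def)
    have b: "b \<ge> 0" unfolding b_def by (simp add: sum_nonneg)
    \<comment> \<open>The step changes the squared distance by \<open>- s * (2 * a - s * b)\<close>.
      The denominator \<open>b + 1\<close> keeps \<open>s\<close> positive even for
      \<open>b = 0\<close>, and the cap 1 keeps \<open>l'\<close> a convex combination.\<close>
    define s where "s = min 1 (a / (b + 1))"
    have s: "0 < s" "s \<le> 1" using a b by (auto simp: s_def)
    have sb: "s * b < 2 * a"
    proof -
      have "s * (b + 1) \<le> a / (b + 1) * (b + 1)"
        using b by (intro mult_right_mono) (auto simp: s_def)
      also have "\<dots> = a" using b by simp
      finally have "s * (b + 1) \<le> a" .
      then show ?thesis using s a b by (simp add: algebra_simps)
    qed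
    define l' where "l' = (\<lambda>u. (1 - s) * l u + (if u = z then s else 0))"
    have "l' \<in> B"
      unfolding B_def l'_def using s l01 lz z
      by (auto simp: PiE_def Pi_def mult_le_one)
        (smt (verit) mult_left_le)
    moreover have "(\<Sum>u\<in>Z. l' u) = 1"
      using z fin lsum by (simp add: l'_def sum.distrib flip: sum_distrib_left)
    ultimately have "l' \<in> D" by (simp add: D_def)
    have "(\<Sum>u\<in>Z. l' u * u i) = p i + s * (z i - p i)" for i
    proof -
      have "(\<Sum>u\<in>Z. l' u * u i) = (\<Sum>u\<in>Z. (1 - s) * (l u * u i) + (if u = z then s * z i else 0))"
        by (rule sum.cong) (auto simp: l'_def algebra_simps)
      also have "\<dots> = (1 - s) * p i + s * z i"
        using z fin by (simp add: sum.distrib p_def flip: sum_distrib_left)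
      finally show ?thesis by (simp add: algebra_simps)
    qed
    then have "d l' = (\<Sum>i\<in>C. (w i - s * (z i - p i))^2)"
      by (simp add: d_def w_def diff_diff_eq)
    also have "\<dots> = (\<Sum>i\<in>C. (w i)^2 - 2 * s * (w i * (z i - p i)) + s^2 * (z i - p i)^2)"
      by (rule sum.cong) (auto simp: power2_eq_square algebra_simps)
    also have "\<dots> = d l - 2 * s * a + s^2 * b"
      by (simp add: sum.distrib sum_subtractf a_def b_def d_def w_def p_def flip: sum_distrib_left)
    also have "\<dots> = d l - s * (2 * a - s * b)"
      by (simp add: algebra_simps power2_eq_square)
    also have "\<dots> < d l" using s sb by simp
    finally show False using lmin[OF \<open>l' \<in> D\<close>] by simp
  qed
  have pos: "(\<Sum>i\<in>C. (w i)^2) > 0"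
  proof (rule ccontr)
    assume "\<not> ?thesis"
    then have "(\<Sum>i\<in>C. (w i)^2) = 0"
      using sum_nonneg[of C "\<lambda>i. (w i)^2"] by simp
    then have "\<forall>i\<in>C. w i = 0" using fin by (simp add: sum_nonneg_eq_0_iff)
    then have "x i = p i" for i
    proof (cases "i \<in> C")
      case False
      then have "p i = 0" unfolding p_def by (intro sum.neutral) (simp add: Z0)
      then show ?thesis using False x0 by simp
    qed (simp add: w_def)
    then have xp: "x = (\<Sum>z\<in>Z. l z *\<^sub>R z)"
    proof -
      have "(\<Sum>z\<in>Z. l z *\<^sub>R z) i = (\<Sum>z\<in>Z. l z * z i)" for i
        using \<open>finite Z\<close> by (induction Z rule: finite_induct) (auto simp: scaleR_fun_def)
      then show ?thesis using \<open>\<And>i. x i = p i\<close> by (auto simp: p_def fun_eq_iff)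
    qed
    have "x \<in> convex hull Z"
      unfolding convex_hull_finite[OF \<open>finite Z\<close>] using xp l01 lsum by blast
    then show False using nx by simp
  qed
  show ?thesis
  proof (intro exI ballI)
    fix z assume z: "z \<in> Z"
    have "(\<Sum>i\<in>C. w i * x i) - (\<Sum>i\<in>C. w i * z i)
        = (\<Sum>i\<in>C. (w i)^2) - (\<Sum>i\<in>C. w i * (z i - p i))"
      unfolding sum_subtractf[symmetric]
      by (rule sum.cong) (auto simp: w_def power2_eq_square algebra_simps)
    then show "(\<Sum>i\<in>C. w i * z i) < (\<Sum>i\<in>C. w i * x i)"
      using obtuse[OF z] pos by linarith
  qed
qed

section \<open>Exchanging matchings along an alternating path\<close>

text \<open>Two involutions generate a dihedral group, whose finite orbits are paths and cycles of
  alternating steps, and fixed points are ends of paths. One end is \<open>t\<close>, fixed by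
  \<open>g\<close>, which leaves at most one end for \<open>f\<close>.\<close>

lemma dihedral_orbit:
  fixes f g :: "'a \<Rightarrow> 'a"
  assumes ff: "\<And>x. f (f x) = x" and gg: "\<And>x. g (g x) = x" and gt: "g t = t"
    and fin: "finite (range (\<lambda>i. ((f \<circ> g) ^^ i) t))" (is "finite ?C")
  shows "t \<in> ?C" "\<And>x. x \<in> ?C \<Longrightarrow> f x \<in> ?C" "\<And>x. x \<in> ?C \<Longrightarrow> g x \<in> ?C"
    and "\<And>u v. u \<in> ?C \<Longrightarrow> v \<in> ?C \<Longrightarrow> f u = u \<Longrightarrow> f v = v \<Longrightarrow> f t \<noteq> t \<Longrightarrow> u = v"
proof -
  define h where "h = f \<circ> g"
  have "inj h" unfolding h_def by (rule injI) (metis comp_apply ff gg)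
  then have inj: "(h ^^ i) x = (h ^^ i) y \<longleftrightarrow> x = y" for i x y
    by (meson inj_eq inj_fn)
  have fixmult: "(h ^^ (b * a)) x = x" if "(h ^^ a) x = x" for a b x
    using that by (induction b) (auto simp: funpow_add)
  have "\<not> inj (\<lambda>i. (h ^^ i) t)"
    using fin unfolding h_def[symmetric] by (meson finite_imageD infinite_UNIV_nat)
  then obtain i j where ij: "i < j" "(h ^^ i) t = (h ^^ j) t"
    unfolding inj_def by (metis linorder_neqE_nat)
  define m where "m = j - i"
  have m: "m > 0" "(h ^^ m) t = t"
  proof -
    have "j = i + m" using ij by (simp add: m_def)
    then have "(h ^^ i) t = (h ^^ i) ((h ^^ m) t)" using ij by (simp add: funpow_add)
    then show "(h ^^ m) t = t" by (simp add: inj)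
  qed (use ij in \<open>simp add: m_def\<close>)
  \<comment> \<open>Conjugation by the reflection \<open>g\<close> inverts the rotation
    \<open>h\<close>.\<close>
  have hgh: "h (g (h y)) = g y" for y by (simp add: h_def ff gg)
  have refl: "(h ^^ i) (g ((h ^^ i) t)) = t" for i
  proof (induction i)
    case (Suc i)
    have "(h ^^ Suc i) (g ((h ^^ Suc i) t)) = (h ^^ i) (h (g (h ((h ^^ i) t))))"
      by (simp add: funpow_swap1)
    then show ?case using Suc by (simp add: hgh)
  qed (simp add: gt)
  \<comment> \<open>This is the power \<open>- i\<close> of \<open>h\<close>; the multiple
    \<open>m * i\<close> of the period makes the exponent nonnegative.\<close>
  have g_pow: "g ((h ^^ i) t) = (h ^^ (m * i - i)) t" for i
  proof -
    have "(h ^^ i) ((h ^^ (m * i - i)) t) = (h ^^ (i * m)) t"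
      using m by (simp add: mult.commute flip: funpow_add comp_apply[of "h ^^ i"])
    then have "(h ^^ i) ((h ^^ (m * i - i)) t) = (h ^^ i) (g ((h ^^ i) t))"
      using fixmult[OF m(2)] refl by metis
    then show ?thesis by (simp add: inj)
  qed
  have fh: "f x = h (g x)" for x by (simp add: h_def gg)
  have C: "?C = range (\<lambda>i. (h ^^ i) t)" by (simp add: h_def)
  show "t \<in> ?C" unfolding C by (metis funpow_0 rangeI)
  show gC: "g x \<in> ?C" if "x \<in> ?C" for x using that unfolding C by (auto simp: g_pow)
  show "f x \<in> ?C" if x: "x \<in> ?C" for x
  proof -
    obtain i where "g x = (h ^^ i) t" using gC[OF x] unfolding C by auto
    then have "f x = (h ^^ Suc i) t" by (simp add: fh)
    then show ?thesis unfolding C by blast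
  qed
  \<comment> \<open>So a fixed point of \<open>f\<close> at a position \<open>i > 0\<close> makes
    the odd number \<open>2 * i - 1\<close> a period of \<open>t\<close>.\<close>
  have fixed: "(h ^^ (2 * i)) t = h t" if "f ((h ^^ i) t) = (h ^^ i) t" for i
  proof -
    have "(h ^^ (2 * i)) t = (h ^^ i) (f ((h ^^ i) t))"
      using that by (simp add: mult_2 funpow_add)
    also have "\<dots> = h ((h ^^ i) (g ((h ^^ i) t)))"
      by (simp add: fh funpow_swap1)
    finally show ?thesis by (simp add: refl)
  qed
  have eq: "(h ^^ i) t = (h ^^ j) t"
    if "i \<le> j" "f ((h ^^ i) t) = (h ^^ i) t" "f ((h ^^ j) t) = (h ^^ j) t" "f t \<noteq> t" for i j
  proof -
    define d where "d = j - i"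
    have j: "j = i + d" using that by (simp add: d_def)
    have "i \<noteq> 0" using that(2,4) by (metis funpow_0)
    then have "2 * i = Suc (2 * i - 1)" by simp
    then have "h ((h ^^ (2 * i - 1)) t) = h t"
      using fixed[OF that(2)] by (metis comp_apply funpow.simps(2))
    then have odd: "(h ^^ (2 * i - 1)) t = t" using \<open>inj h\<close> by (simp add: inj_eq)
    have "(h ^^ (2 * i)) ((h ^^ (2 * d)) t) = (h ^^ (2 * i)) t"
    proof -
      have "2 * j = 2 * d + 2 * i" by (simp add: j)
      then have "(h ^^ (2 * j)) t = (h ^^ (2 * i)) ((h ^^ (2 * d)) t)"
        by (metis add.commute comp_apply funpow_add)
      then show ?thesis using fixed[OF that(2)] fixed[OF that(3)] by simp
    qed
    then have "(h ^^ (2 * d)) t = t" by (simp only: inj)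
    then have "(h ^^ (i * (2 * d))) t = t" by (rule fixmult)
    \<comment> \<open>Both \<open>2 * d\<close> and \<open>2 * i - 1\<close> are periods; the
      identity writes \<open>d\<close> as a difference of multiples of them, so \<open>d\<close> is
      a period too.\<close>
    moreover have "i * (2 * d) = d + d * (2 * i - 1)"
      using \<open>i \<noteq> 0\<close> by (cases i) (auto simp: algebra_simps)
    ultimately have "(h ^^ d) ((h ^^ (d * (2 * i - 1))) t) = t" by (simp add: funpow_add)
    then have "(h ^^ d) t = t" using fixmult[OF odd] by simp
    then show ?thesis by (simp add: j funpow_add)
  qed
  show "u = v" if "u \<in> ?C" "v \<in> ?C" "f u = u" "f v = v" "f t \<noteq> t" for u v
  proof -
    obtain i j where "u = (h ^^ i) t" "v = (h ^^ j) t" using \<open>u \<in> ?C\<close> \<open>v \<in> ?C\<close> unfolding C by blast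
    then show ?thesis using eq[of i j] eq[of j i] that(3-5) by (cases "i \<le> j") auto
  qed
qed

section \<open>Matchings and their partner involutions\<close>

definition matchings :: "'v set set \<Rightarrow> 'v set set set"
  where "matchings E = {M. M \<subseteq> E \<and> pairwise disjnt M}"

lemma matchings_same_edge:
  "M \<in> matchings E \<Longrightarrow> e \<in> M \<Longrightarrow> e' \<in> M \<Longrightarrow> v \<in> e \<Longrightarrow> v \<in> e' \<Longrightarrow> e = e'"
  by (auto simp: matchings_def pairwise_def disjnt_def)

lemma matchings_subset: "M \<in> matchings E \<Longrightarrow> N \<subseteq> M \<Longrightarrow> N \<in> matchings E"
  unfolding matchings_def using pairwise_subset by blast

lemma matchings_mono: "S \<subseteq> E \<Longrightarrow> matchings S \<subseteq> matchings E"
  by (auto simp: matchings_def)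

lemma finite_matchings: "finite E \<Longrightarrow> finite (matchings E)"
  by (rule finite_subset[of _ "Pow E"]) (auto simp: matchings_def)

lemma finite_complete_edges: "finite V \<Longrightarrow> finite (complete_edges V)"
  by (rule finite_subset[of _ "Pow V"]) (auto simp: complete_edges_def)

text \<open>Uncovered vertices become fixed points. A matching is thus an involution of the whole
  vertex type, and the components of two superposed matchings are orbits of two involutions.\<close>

definition partner :: "'v set set \<Rightarrow> 'v \<Rightarrow> 'v"
  where "partner M x = (if \<exists>y. y \<noteq> x \<and> {x, y} \<in> M then THE y. y \<noteq> x \<and> {x, y} \<in> M else x)"

context
  fixes V :: "'v set" and E M :: "'v set set"
  assumes E: "E \<subseteq> complete_edges V" and M: "M \<in> matchings E"
begin

lemma partner_eq: "y \<noteq> x \<Longrightarrow> {x, y} \<in> M \<Longrightarrow> partner M x = y"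
proof -
  assume y: "y \<noteq> x" "{x, y} \<in> M"
  have "z = y" if "z \<noteq> x" "{x, z} \<in> M" for z
  proof -
    have "{x, y} = {x, z}" by (rule matchings_same_edge[OF M y(2) that(2), of x]) simp_all
    then show ?thesis using that(1) y(1) by (simp add: doubleton_eq_iff)
  qed
  then have "(THE z. z \<noteq> x \<and> {x, z} \<in> M) = y" using y by (intro the_equality) blast+
  moreover have "partner M x = (THE z. z \<noteq> x \<and> {x, z} \<in> M)"
    unfolding partner_def using y by (intro if_P) blast
  ultimately show ?thesis by simp
qed

lemma matching_edge: "e \<in> M \<Longrightarrow> x \<in> e \<Longrightarrow> \<exists>y. y \<noteq> x \<and> e = {x, y}"
proof -
  assume e: "e \<in> M" "x \<in> e"
  then have "card e = 2" using M E by (auto simp: matchings_def complete_edges_def)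
  then obtain a b where "e = {a, b}" "a \<noteq> b" by (auto simp: card_2_iff)
  then show ?thesis using e by (cases "x = a") (auto simp: insert_commute)
qed

lemma partner_fixed: "partner M x = x \<longleftrightarrow> x \<notin> \<Union>M"
proof
  assume "partner M x = x"
  show "x \<notin> \<Union>M"
  proof
    assume "x \<in> \<Union>M"
    then obtain e where "e \<in> M" "x \<in> e" by blast
    then obtain y where "y \<noteq> x" "{x, y} \<in> M" using matching_edge by blast
    then show False using partner_eq \<open>partner M x = x\<close> by metis
  qed
next
  assume "x \<notin> \<Union>M"
  then show "partner M x = x" by (auto simp: partner_def)
qed

lemma partner_cases: "partner M x = x \<or> (partner M x \<noteq> x \<and> {x, partner M x} \<in> M)"
  using partner_eq by (metis partner_def)

lemma partner_partner: "partner M (partner M x) = x"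
  using partner_cases[of x] partner_eq[of x "partner M x"] by (auto simp: insert_commute)

lemma partner_in: "x \<in> V \<Longrightarrow> partner M x \<in> V"
  using partner_cases[of x] M E by (auto simp: matchings_def complete_edges_def)

lemma partner_closed:
  assumes "\<And>x. x \<in> C \<Longrightarrow> partner M x \<in> C" "e \<in> M"
  shows "e \<subseteq> C \<or> e \<inter> C = {}"
proof (rule ccontr)
  assume "\<not> ?thesis"
  then obtain x where x: "x \<in> e" "x \<in> C" "\<not> e \<subseteq> C" by auto
  then obtain y where "y \<noteq> x" "e = {x, y}" using matching_edge assms by blast
  then show False using assms x partner_eq by fastforce
qed

end

definition switch :: "'v set \<Rightarrow> 'v set set \<Rightarrow> 'v set set \<Rightarrow> 'v set set"
  where "switch C M N = {e \<in> M. e \<inter> C = {}} \<union> {e \<in> N. e \<subseteq> C}"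

lemma switch_matching:
  assumes "M \<in> matchings E" "N \<in> matchings E"
  shows "switch C M N \<in> matchings E"
  unfolding matchings_def mem_Collect_eq
proof (intro conjI pairwiseI)
  show "switch C M N \<subseteq> E" using assms by (auto simp: switch_def matchings_def)
next
  fix e e' assume "e \<in> switch C M N" "e' \<in> switch C M N" "e \<noteq> e'"
  moreover have "disjnt e e'" if "e \<in> A" "e' \<in> A" "e \<noteq> e'" "A \<in> matchings E" for A
    using that by (auto simp: matchings_def pairwise_def)
  ultimately show "disjnt e e'"
    using assms by (auto simp: switch_def disjnt_def)
qed

text \<open>The switched pair redistributes the edges of the original pair. An empty edge would
  count as both inside and outside \<open>C\<close>, which is why it is excluded.\<close>

lemma sum_switch:
  fixes w :: "'v set \<Rightarrow> real"
  assumes "finite M" "finite N" and ne: "{} \<notin> M \<union> N"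
    and cl: "\<And>e. e \<in> M \<union> N \<Longrightarrow> e \<subseteq> C \<or> e \<inter> C = {}"
  shows "sum w (switch C M N) + sum w (switch C N M) = sum w M + sum w N"
proof -
  have split: "sum w A = sum w {e \<in> A. e \<inter> C = {}} + sum w {e \<in> A. e \<subseteq> C}"
    if "finite A" "A \<subseteq> M \<union> N" for A
  proof -
    have "A = {e \<in> A. e \<inter> C = {}} \<union> {e \<in> A. e \<subseteq> C}" using that cl by auto
    moreover have "sum w ({e \<in> A. e \<inter> C = {}} \<union> {e \<in> A. e \<subseteq> C})
        = sum w {e \<in> A. e \<inter> C = {}} + sum w {e \<in> A. e \<subseteq> C}"
      by (rule sum.union_disjoint) (use that ne in \<open>auto simp: Int_absorb2\<close>)
    ultimately show ?thesis by simp
  qed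
  have sw: "sum w (switch C A B) = sum w {e \<in> A. e \<inter> C = {}} + sum w {e \<in> B. e \<subseteq> C}"
    if "finite A" "finite B" "A \<subseteq> M \<union> N" for A B
    unfolding switch_def by (rule sum.union_disjoint) (use that ne in \<open>auto simp: Int_absorb2\<close>)
  show ?thesis using split[of M] split[of N] sw[of M N] sw[of N M] assms by simp
qed

text \<open>The component of \<open>t\<close> in the symmetric difference of \<open>M\<close> and \<open>N\<close> is a path that starts
  in \<open>t\<close>, hence it cannot end both in \<open>u\<close> and in \<open>v\<close>.\<close>

lemma matching_exchange:
  assumes V: "finite V" and E: "E \<subseteq> complete_edges V"
    and M: "M \<in> matchings E" and N: "N \<in> matchings E"
    and u: "u \<notin> \<Union>M" and v: "v \<notin> \<Union>M" and uv: "u \<noteq> v"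
    and t: "t \<in> \<Union>M" "t \<notin> \<Union>N"
  shows "\<exists>M'\<in>matchings E. \<exists>N'\<in>matchings E.
    (\<forall>w :: 'v set \<Rightarrow> real. sum w M' + sum w N' = sum w M + sum w N) \<and>
    t \<notin> \<Union>M' \<and> (u \<notin> \<Union>M' \<or> v \<notin> \<Union>M')"
proof -
  define f where "f = partner M"
  define g where "g = partner N"
  define C where "C = range (\<lambda>i. ((f \<circ> g) ^^ i) t)"
  have tV: "t \<in> V" using t M E by (auto simp: matchings_def complete_edges_def)
  have "((f \<circ> g) ^^ i) t \<in> V" for i
  proof (induction i)
    case (Suc i)
    then show ?case
      unfolding f_def g_def by (simp add: partner_in[OF E M] partner_in[OF E N])
  qed (simp add: tV)
  then have finC: "finite C" using V unfolding C_def by (meson finite_subset image_subsetI)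
  have ff: "f (f x) = x" "g (g x) = x" for x
    by (simp_all add: f_def g_def partner_partner[OF E M] partner_partner[OF E N])
  have gt: "g t = t" using t partner_fixed[OF E N] by (simp add: g_def)
  note orb = dihedral_orbit[of f g t, OF ff gt finC[unfolded C_def], folded C_def]
  have "\<not> (u \<in> C \<and> v \<in> C)"
    using orb(4)[of u v] u v t uv partner_fixed[OF E M] by (auto simp: f_def)
  then have uvC: "u \<notin> C \<or> v \<notin> C" by blast
  have cl: "e \<subseteq> C \<or> e \<inter> C = {}" if "e \<in> M \<union> N" for e
    using that partner_closed[OF E M, of C e] partner_closed[OF E N, of C e] orb(2,3)
    by (auto simp: f_def g_def)
  have "finite E" using finite_subset[OF E finite_complete_edges[OF V]] .
  then have fin: "finite M" "finite N"
    using M N by (auto simp: matchings_def intro: finite_subset)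
  have "card e = 2" if "e \<in> M \<union> N" for e
    using that M N E by (auto simp: matchings_def complete_edges_def)
  then have "{} \<notin> M \<union> N" by (metis card.empty zero_neq_numeral)
  then have "sum w (switch C M N) + sum w (switch C N M) = sum w M + sum w N"
    for w :: "'v set \<Rightarrow> real"
    using sum_switch[OF fin _ cl] by blast
  moreover have "t \<notin> \<Union>(switch C M N)" using t orb(1) by (auto simp: switch_def)
  \<comment> \<open>Switching adds edges only inside \<open>C\<close>, so whichever of
    \<open>u\<close> and \<open>v\<close> is outside stays uncovered.\<close>
  moreover have "u \<notin> \<Union>(switch C M N) \<or> v \<notin> \<Union>(switch C M N)"
    using uvC u v by (auto simp: switch_def)
  ultimately show ?thesis
    by (intro bexI[of _ "switch C M N"] bexI[of _ "switch C N M"] switch_matching M N) blast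
qed

lemma finite_positive_lower_bound:
  fixes f :: "'a \<Rightarrow> real"
  assumes "finite A" "\<And>a. a \<in> A \<Longrightarrow> f a > 0"
  obtains d where "d > 0" "\<And>a. a \<in> A \<Longrightarrow> d \<le> f a"
proof -
  have "\<exists>d>0. \<forall>a\<in>A. d \<le> f a"
    using assms
  proof (induction A rule: finite_induct)
    case (insert x A)
    then obtain d where "d > 0" "\<forall>a\<in>A. d \<le> f a" by auto
    then show ?case using insert.prems by (intro exI[of _ "min d (f x)"]) auto
  qed (auto intro: exI[of _ 1])
  then show ?thesis using that by blast
qed

lemma card_matching_vertices:
  assumes "finite V" "E \<subseteq> complete_edges V" "N \<in> matchings E"
  shows "card (\<Union>N) = 2 * card N"
proof -
  have N: "N \<subseteq> Pow V" "\<And>e. e \<in> N \<Longrightarrow> card e = 2" "pairwise disjnt N"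
    using assms by (auto simp: matchings_def complete_edges_def)
  then have "card (\<Union>N) = (\<Sum>e\<in>N. card e)"
    using assms(1) by (intro card_Union_disjoint) (auto intro: finite_subset)
  then show ?thesis using N by simp
qed

section \<open>The matching polytope\<close>

text \<open>At a maximiser \<open>w\<close> over the polar of the matchings with \<open>w \<cdot> x > 1\<close>, call a matching in the
  support of \<open>w\<close> tight if it has weight 1. If all tight matchings have at least \<open>b\<close> edges in a set \<open>A\<close>
  with \<open>x(A) \<le> b\<close>, then decreasing \<open>w\<close> on \<open>A\<close> and rescaling would increase \<open>w \<cdot> x\<close>. Such
  a set is either the star of a vertex covered by all tight matchings, or it consists of the edges inside a
  Gallai class, that is, a class of vertices no two of which are missed by one tight matching.\<close>

lemma matching_polar_bound:
  fixes x w :: "'v set \<Rightarrow> real"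
  assumes V: "finite V" and E: "E \<subseteq> complete_edges V"
    and x0: "\<And>e. e \<in> E \<Longrightarrow> 0 \<le> x e"
    and star: "\<And>v. v \<in> V \<Longrightarrow> (\<Sum>e\<in>{e \<in> E. v \<in> e}. x e) \<le> 1"
    and blossom: "\<And>U. U \<subseteq> V \<Longrightarrow> odd (card U) \<Longrightarrow>
      (\<Sum>e\<in>{e \<in> E. e \<subseteq> U}. x e) \<le> (real (card U) - 1) / 2"
    and w: "\<And>e. e \<in> E \<Longrightarrow> 0 \<le> w e" "\<And>M. M \<in> matchings E \<Longrightarrow> sum w M \<le> 1"
  shows "(\<Sum>e\<in>E. w e * x e) \<le> 1"
proof (rule ccontr)
  assume gt: "\<not> ?thesis"
  have finE: "finite E" using finite_subset[OF E finite_complete_edges[OF V]] .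
  define Q where "Q = (\<lambda>w :: 'v set \<Rightarrow> real. (\<forall>e\<in>E. 0 \<le> w e) \<and> (\<forall>e. e \<notin> E \<longrightarrow> w e = 0) \<and>
      (\<forall>M\<in>matchings E. sum w M \<le> 1))"
  define B where "B = (\<Pi>\<^sub>E e\<in>UNIV. if e \<in> E then {0..1::real} else {0})"
  have cB: "compact B"
    unfolding B_def
    by (subst compactin_euclidean_iff [symmetric], subst euclidean_product_topology [symmetric],
        subst compactin_PiE) auto
  have single: "w e \<le> 1" if "\<And>M. M \<in> matchings E \<Longrightarrow> sum w M \<le> 1" "e \<in> E" for w :: "'v set \<Rightarrow> real" and e
    using that(1)[of "{e}"] that(2) by (auto simp: matchings_def)
  have "Collect Q = B \<inter> (\<Inter>M\<in>matchings E. {w. sum w M \<le> 1})"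
  proof (intro equalityI subsetI)
    fix w assume "w \<in> Collect Q"
    then show "w \<in> B \<inter> (\<Inter>M\<in>matchings E. {w. sum w M \<le> 1})"
      using single[of w] by (auto simp: Q_def B_def PiE_def Pi_def)
  next
    fix w assume w: "w \<in> B \<inter> (\<Inter>M\<in>matchings E. {w. sum w M \<le> 1})"
    then have "w e \<in> (if e \<in> E then {0..1} else {0})" for e
      unfolding B_def by (blast dest: PiE_mem)
    then have "(e \<in> E \<longrightarrow> 0 \<le> w e) \<and> (e \<notin> E \<longrightarrow> w e = 0)" for e
      by (metis atLeastAtMost_iff singletonD)
    then show "w \<in> Collect Q" using w by (auto simp: Q_def)
  qed
  moreover have "closed (\<Inter>M\<in>matchings E. {w :: 'v set \<Rightarrow> real. sum w M \<le> 1})"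
    by (intro closed_INT ballI closed_Collect_le continuous_intros continuous_on_product_coordinates)
  ultimately have "compact (Collect Q)" using compact_Int_closed[OF cB] by simp
  moreover have "continuous_on (Collect Q) (\<lambda>w. \<Sum>e\<in>E. w e * x e)"
    by (intro continuous_intros continuous_on_subset[OF continuous_on_product_coordinates]) auto
  moreover have wQ: "(\<lambda>e. if e \<in> E then w e else 0) \<in> Collect Q" (is "?w \<in> _")
  proof -
    have "sum ?w M = sum w M" if "M \<in> matchings E" for M
      using that by (intro sum.cong) (auto simp: matchings_def)
    then show ?thesis using w by (auto simp: Q_def)
  qed
  ultimately have "\<exists>m\<in>Collect Q. \<forall>w\<in>Collect Q. (\<Sum>e\<in>E. w e * x e) \<le> (\<Sum>e\<in>E. m e * x e)"
    by (intro continuous_attains_sup) auto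
  then obtain m where m: "Q m" and max: "\<And>w. Q w \<Longrightarrow> (\<Sum>e\<in>E. w e * x e) \<le> (\<Sum>e\<in>E. m e * x e)"
    by auto
  define val where "val = (\<Sum>e\<in>E. m e * x e)"
  have "(\<Sum>e\<in>E. ?w e * x e) = (\<Sum>e\<in>E. w e * x e)" by (rule sum.cong) auto
  then have val: "val > 1" using max[of ?w] wQ gt by (simp add: val_def)
  have m0: "0 \<le> m e" "e \<notin> E \<Longrightarrow> m e = 0" for e using m by (cases "e \<in> E"; auto simp: Q_def)+
  define S where "S = {e \<in> E. m e > 0}"
  have S: "S \<subseteq> E" "S \<subseteq> complete_edges V" "finite S" using E finE by (auto simp: S_def)
  define tight where "tight = {M \<in> matchings S. sum m M = 1}"
  have le1: "sum m M \<le> 1" if "M \<in> matchings S" for M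
    using that m matchings_mono[OF S(1)] by (auto simp: Q_def)
  have key: False
    if A: "A \<subseteq> S" and b: "b > 0" "sum x A \<le> b" and N: "\<And>N. N \<in> tight \<Longrightarrow> b \<le> real (card (N \<inter> A))" for A b
  proof -
    have "finite (matchings S - tight)" using finite_matchings[OF S(3)] by simp
    moreover have "1 - sum m M > 0" if "M \<in> matchings S - tight" for M
      using that le1[of M] by (auto simp: tight_def)
    ultimately obtain d where d: "d > 0" "\<And>M. M \<in> matchings S - tight \<Longrightarrow> d \<le> 1 - sum m M"
      using finite_positive_lower_bound[of "matchings S - tight" "\<lambda>M. 1 - sum m M"] by blast
    have "finite A" using A S(3) finite_subset by blast
    then obtain \<mu> where \<mu>: "\<mu> > 0" "\<And>e. e \<in> A \<Longrightarrow> \<mu> \<le> m e"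
      using finite_positive_lower_bound[of A m] A by (auto simp: S_def)
    \<comment> \<open>The three bounds keep the weights on \<open>A\<close> nonnegative, keep
      matchings that are not tight at weight at most 1 after rescaling, and keep the divisor
      \<open>1 - \<epsilon> * b\<close> positive.\<close>
    define \<epsilon> where "\<epsilon> = min \<mu> (min (d / b) (1 / (2 * b)))"
    have \<epsilon>: "\<epsilon> > 0" "\<epsilon> \<le> \<mu>" "\<epsilon> * b \<le> d" "\<epsilon> * b < 1"
    proof -
      show "\<epsilon> > 0" "\<epsilon> \<le> \<mu>" using \<mu> d b by (auto simp: \<epsilon>_def)
      have "\<epsilon> * b \<le> d / b * b" using b by (intro mult_right_mono) (auto simp: \<epsilon>_def)
      then show "\<epsilon> * b \<le> d" using b by simp
      have "\<epsilon> * b \<le> 1 / (2 * b) * b" using b by (intro mult_right_mono) (auto simp: \<epsilon>_def)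
      then show "\<epsilon> * b < 1" using b by simp
    qed
    define m' where "m' = (\<lambda>e. (m e - (if e \<in> A then \<epsilon> else 0)) / (1 - \<epsilon> * b))"
    have sumA: "(\<Sum>e\<in>M. if e \<in> A then c e else 0) = sum c (M \<inter> A)" if "finite M" for M and c :: "'v set \<Rightarrow> real"
      using that by (simp add: sum.inter_restrict)
    have "Q m'"
      unfolding Q_def
    proof (intro conjI ballI allI impI)
      fix e
      show "0 \<le> m' e" using \<epsilon> \<mu>(2)[of e] m0(1)[of e] by (auto simp: m'_def)
      show "m' e = 0" if "e \<notin> E" using that A m0(2)[of e] S by (auto simp: m'_def)
    next
      fix M assume M: "M \<in> matchings E"
      then have finM: "finite M" using finE by (auto simp: matchings_def intro: finite_subset)
      define N where "N = M \<inter> S"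
      have NS: "N \<in> matchings S" using matchings_subset[OF M, of N] by (auto simp: N_def matchings_def)
      have "sum m M = sum m N"
      proof (intro sum.mono_neutral_right ballI)
        fix e assume "e \<in> M - N"
        then have "\<not> m e > 0" using M by (auto simp: N_def S_def matchings_def)
        then show "m e = 0" using m0(1)[of e] by simp
      qed (use finM in \<open>auto simp: N_def\<close>)
      moreover have "M \<inter> A = N \<inter> A" using A by (auto simp: N_def)
      ultimately have eq: "sum m' M = (sum m N - \<epsilon> * card (N \<inter> A)) / (1 - \<epsilon> * b)"
        using sumA[OF finM, of "\<lambda>_. \<epsilon>"]
        by (simp add: m'_def sum_subtractf mult.commute flip: sum_divide_distrib)
      have "sum m N - \<epsilon> * card (N \<inter> A) \<le> 1 - \<epsilon> * b"
      proof (cases "N \<in> tight")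
        case True
        then show ?thesis using N[OF True] \<epsilon> by (auto simp: tight_def)
      next
        case False
        have "0 \<le> \<epsilon> * card (N \<inter> A)" using \<epsilon> by simp
        moreover have "d \<le> 1 - sum m N" using d(2) False NS by blast
        ultimately show ?thesis using \<epsilon> by linarith
      qed
      then show "sum m' M \<le> 1" using \<epsilon> by (simp add: eq)
    qed
    then have "(\<Sum>e\<in>E. m' e * x e) \<le> val" using max by (simp add: val_def)
    moreover have "(\<Sum>e\<in>E. m' e * x e) = (val - \<epsilon> * sum x A) / (1 - \<epsilon> * b)"
    proof -
      have "(\<Sum>e\<in>E. m' e * x e) = (\<Sum>e\<in>E. (m e * x e - (if e \<in> A then \<epsilon> * x e else 0)) / (1 - \<epsilon> * b))"
        by (rule sum.cong) (auto simp: m'_def algebra_simps)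
      also have "\<dots> = (val - (\<Sum>e\<in>E. if e \<in> A then \<epsilon> * x e else 0)) / (1 - \<epsilon> * b)"
        by (simp add: val_def sum_subtractf flip: sum_divide_distrib)
      also have "E \<inter> A = A" using A S by blast
      then have "(\<Sum>e\<in>E. if e \<in> A then \<epsilon> * x e else 0) = \<epsilon> * sum x A"
        using sumA[OF finE, of "\<lambda>e. \<epsilon> * x e"] by (simp add: sum_distrib_left)
      finally show ?thesis .
    qed
    ultimately have "val - \<epsilon> * sum x A \<le> val * (1 - \<epsilon> * b)"
      using \<epsilon> by (simp add: pos_divide_le_eq)
    moreover have "\<epsilon> * sum x A \<le> \<epsilon> * b" using b \<epsilon> by simp
    \<comment> \<open>Since \<open>val > 1\<close>, the gain from rescaling exceeds the loss of at
      most \<open>\<epsilon> * b\<close>.\<close>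
    moreover have "\<epsilon> * b * val > \<epsilon> * b * 1" using b \<epsilon> val by (intro mult_strict_left_mono) auto
    ultimately show False by (simp add: algebra_simps)
  qed
  have Nfin: "finite N" "N \<subseteq> S" "N \<in> matchings S" if "N \<in> tight" for N
    using that S(3) by (auto simp: tight_def matchings_def intro: finite_subset)
  have missed: "\<exists>N\<in>tight. v \<notin> \<Union>N" if v: "v \<in> V" for v
  proof (rule ccontr)
    assume none: "\<not> ?thesis"
    show False
    proof (rule key[of "{e \<in> S. v \<in> e}" 1])
      have "sum x {e \<in> S. v \<in> e} \<le> sum x {e \<in> E. v \<in> e}"
        using finE S x0 by (intro sum_mono2) auto
      then show "sum x {e \<in> S. v \<in> e} \<le> 1" using star[OF v] by simp
    next
      fix N assume N: "N \<in> tight"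
      then obtain e where "e \<in> N \<inter> {e \<in> S. v \<in> e}" using none Nfin[OF N] by blast
      then have "card (N \<inter> {e \<in> S. v \<in> e}) > 0" using Nfin[OF N] by (auto simp: card_gt_0_iff)
      then show "1 \<le> real (card (N \<inter> {e \<in> S. v \<in> e}))" by simp
    qed auto
  qed
  define R where "R = (\<lambda>u v. u = v \<or> \<not> (\<exists>N\<in>tight. u \<notin> \<Union>N \<and> v \<notin> \<Union>N))"
  have R_sym: "R u v \<Longrightarrow> R v u" for u v by (auto simp: R_def)
  \<comment> \<open>Gallai's argument: the exchange yields two matchings of total weight 2, each of
    weight at most 1, so both are tight. The first misses \<open>t\<close> and one of
    \<open>u\<close> and \<open>v\<close>, against one of the two given relations.\<close>
  have R_trans: "R u v" if uvt: "R u t" "R t v" "t \<in> V" for u t v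
  proof (rule ccontr)
    assume "\<not> R u v"
    then obtain M where M: "M \<in> tight" "u \<notin> \<Union>M" "v \<notin> \<Union>M" and uv: "u \<noteq> v" by (auto simp: R_def)
    have ut: "u \<noteq> t" "v \<noteq> t" using uvt(1,2) \<open>\<not> R u v\<close> by auto
    have tM: "t \<in> \<Union>M" using uvt M ut by (auto simp: R_def)
    obtain N where N: "N \<in> tight" "t \<notin> \<Union>N" using missed[OF uvt(3)] by blast
    obtain M' N' where M': "M' \<in> matchings S" "N' \<in> matchings S"
      and ex: "(\<forall>w :: 'v set \<Rightarrow> real. sum w M' + sum w N' = sum w M + sum w N) \<and>
        t \<notin> \<Union>M' \<and> (u \<notin> \<Union>M' \<or> v \<notin> \<Union>M')"
      using matching_exchange[OF V S(2) Nfin(3)[OF M(1)] Nfin(3)[OF N(1)] M(2,3) uv tM N(2)]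
      by (elim bexE)
    note miss = ex[THEN conjunct2, THEN conjunct1] ex[THEN conjunct2, THEN conjunct2]
    have "sum m M' + sum m N' = sum m M + sum m N" by (simp only: ex)
    then have "sum m M' + sum m N' = 2" using M N by (simp add: tight_def)
    then have "sum m M' = 1" using le1[OF M'(1)] le1[OF M'(2)] by linarith
    then have "M' \<in> tight" using M' by (simp add: tight_def)
    then show False using miss uvt(1,2) ut by (auto simp: R_def)
  qed
  \<comment> \<open>A tight matching that misses both ends could be enlarged by the edge, whose
    weight is positive.\<close>
  have R_edge: "R u v" if uv: "{u, v} \<in> S" for u v
  proof (rule ccontr)
    assume "\<not> R u v"
    then obtain N where N: "N \<in> tight" "u \<notin> \<Union>N" "v \<notin> \<Union>N" by (auto simp: R_def)
    then have "insert {u, v} N \<in> matchings S"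
      using Nfin[OF N(1)] uv by (auto simp: matchings_def pairwise_insert disjnt_def)
    then have "sum m (insert {u, v} N) \<le> 1" by (rule le1)
    moreover have "{u, v} \<notin> N" using N by auto
    ultimately have "m {u, v} + 1 \<le> 1" using Nfin[OF N(1)] N(1) by (simp add: tight_def)
    then show False using uv by (simp add: S_def)
  qed
  have "S \<noteq> {}"
  proof
    assume "S = {}"
    then have "m e = 0" if "e \<in> E" for e using that m0(1)[of e] by (auto simp: S_def)
    then have "val = 0" by (simp add: val_def)
    then show False using val by simp
  qed
  \<comment> \<open>The class is grown from an edge of the support, so it has at least two vertices
    and the bound passed to \<open>key\<close> is positive.\<close>
  then obtain e0 where e0: "e0 \<in> S" by blast
  then obtain a b where ab: "e0 = {a, b}" "a \<noteq> b" "a \<in> V" "b \<in> V"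
    using S(2) by (auto simp: complete_edges_def card_2_iff)
  define U where "U = {v \<in> V. R a v}"
  have U: "U \<subseteq> V" "finite U" "a \<in> U" "b \<in> U"
    using V ab R_edge[of a b] e0 by (auto simp: U_def R_def)
  have Uedge: "e \<subseteq> U" if e: "e \<in> S" "e \<inter> U \<noteq> {}" for e
  proof -
    have "e \<subseteq> V" "card e = 2" using e S(2) by (auto simp: complete_edges_def)
    then obtain c d where cd: "e = {c, d}" "c \<in> V" "d \<in> V" by (auto simp: card_2_iff)
    have "R c d" "R d c" using R_edge[of c d] R_sym e cd by auto
    then show ?thesis using e(2) cd R_trans[of a c d] R_trans[of a d c] by (auto simp: U_def)
  qed
  \<comment> \<open>Edges of the support that meet \<open>U\<close> lie inside it, so
    \<open>N\<close> covers vertices of \<open>U\<close> in pairs.\<close>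
  have count: "card (U - \<Union>N) + 2 * card {e \<in> N. e \<subseteq> U} = card U" if N: "N \<in> tight" for N
  proof -
    have "{e \<in> N. e \<subseteq> U} \<in> matchings S" using matchings_subset[OF Nfin(3)[OF N]] by auto
    then have "card (\<Union>{e \<in> N. e \<subseteq> U}) = 2 * card {e \<in> N. e \<subseteq> U}"
      by (rule card_matching_vertices[OF V S(2)])
    moreover have "\<Union>{e \<in> N. e \<subseteq> U} = U \<inter> \<Union>N" using Uedge Nfin(2)[OF N] by blast
    ultimately show ?thesis
      using U(2) card_Diff_subset_Int[of U "\<Union>N"] card_mono[of U "U \<inter> \<Union>N"] by auto
  qed
  have atmost: "card (U - \<Union>N) \<le> 1" if N: "N \<in> tight" for N
  proof -
    have "u = v" if "u \<in> U - \<Union>N" "v \<in> U - \<Union>N" for u v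
    proof -
      have "R u v" using that R_trans[of u a v] R_sym ab by (auto simp: U_def)
      then show ?thesis using that N by (auto simp: R_def)
    qed
    then show ?thesis using U(2) by (auto simp: card_le_Suc0_iff_eq)
  qed
  obtain Na where Na: "Na \<in> tight" "a \<notin> \<Union>Na" using missed ab by blast
  have "card (U - \<Union>Na) > 0" using Na U by (auto simp: card_gt_0_iff)
  \<comment> \<open>A tight matching missing \<open>a\<close> misses exactly one vertex of
    \<open>U\<close>. This fixes the parity of \<open>card U\<close>, and then every tight matching
    misses exactly one.\<close>
  then have "odd (card U)" using count[OF Na(1)] atmost[OF Na(1)]
    by presburger
  have exact: "real (card {e \<in> N. e \<subseteq> U}) = (real (card U) - 1) / 2" if N: "N \<in> tight" for N
  proof -
    have "card (U - \<Union>N) = 1"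
      using count[OF N] atmost[OF N] \<open>odd (card U)\<close> by presburger
    then show ?thesis using count[OF N] by simp
  qed
  have "card {a, b} \<le> card U" using U by (intro card_mono) auto
  then have cardU: "card U \<ge> 2" using ab by simp
  show False
  proof (rule key[of "{e \<in> S. e \<subseteq> U}" "(real (card U) - 1) / 2"])
    have "sum x {e \<in> S. e \<subseteq> U} \<le> sum x {e \<in> E. e \<subseteq> U}"
      using finE S x0 by (intro sum_mono2) auto
    then show "sum x {e \<in> S. e \<subseteq> U} \<le> (real (card U) - 1) / 2"
      using blossom[OF U(1) \<open>odd (card U)\<close>] by simp
  next
    fix N assume N: "N \<in> tight"
    then have "N \<inter> {e \<in> S. e \<subseteq> U} = {e \<in> N. e \<subseteq> U}" using Nfin(2) by auto
    then show "(real (card U) - 1) / 2 \<le> real (card (N \<inter> {e \<in> S. e \<subseteq> U}))" using exact[OF N] by simp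
  qed (use cardU in auto)
qed

text \<open>A vector separating \<open>x\<close> from the matchings is scaled into their polar,
  where it contradicts \<open>matching_polar_bound\<close>. This is Edmonds' theorem for an
  arbitrary graph on \<open>V\<close>.\<close>

theorem matching_polytope:
  fixes x :: "'v set \<Rightarrow> real"
  assumes V: "finite V" and E: "E \<subseteq> complete_edges V"
    and x0: "\<And>e. e \<in> E \<Longrightarrow> 0 \<le> x e" "\<And>e. e \<notin> E \<Longrightarrow> x e = 0"
    and star: "\<And>v. v \<in> V \<Longrightarrow> (\<Sum>e\<in>{e \<in> E. v \<in> e}. x e) \<le> 1"
    and blossom: "\<And>U. U \<subseteq> V \<Longrightarrow> odd (card U) \<Longrightarrow>
      (\<Sum>e\<in>{e \<in> E. e \<subseteq> U}. x e) \<le> (real (card U) - 1) / 2"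
  shows "x \<in> convex hull ((\<lambda>M e. if e \<in> M then 1 else 0) ` matchings E)" (is "_ \<in> convex hull (?\<chi> ` _)")
proof (rule ccontr)
  assume "\<not> ?thesis"
  have finE: "finite E" using finite_subset[OF E finite_complete_edges[OF V]] .
  have empty: "{} \<in> matchings E" by (simp add: matchings_def)
  have "\<exists>w. \<forall>z\<in>?\<chi> ` matchings E. (\<Sum>i\<in>E. w i * z i) < (\<Sum>i\<in>E. w i * x i)"
  proof (rule convex_hull_separation)
    show "finite (?\<chi> ` matchings E)" using finite_matchings[OF finE] by simp
    show "x \<notin> convex hull ?\<chi> ` matchings E" by fact
  qed (use finE x0 empty in \<open>auto simp: matchings_def\<close>)
  then obtain w where "\<forall>z\<in>?\<chi> ` matchings E. (\<Sum>i\<in>E. w i * z i) < (\<Sum>i\<in>E. w i * x i)" ..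
  then have w: "(\<Sum>i\<in>E. w i * ?\<chi> M i) < (\<Sum>i\<in>E. w i * x i)" if "M \<in> matchings E" for M
    using that by (rule bspec[OF _ imageI])
  define val where "val = (\<Sum>i\<in>E. w i * x i)"
  have "(\<Sum>i\<in>E. w i * ?\<chi> M i) = sum w M" if "M \<in> matchings E" for M
  proof -
    have "(\<Sum>i\<in>E. w i * ?\<chi> M i) = (\<Sum>i\<in>E. if i \<in> M then w i else 0)" by (rule sum.cong) auto
    also have "\<dots> = sum w (E \<inter> M)" using finE by (simp add: sum.inter_restrict)
    also have "E \<inter> M = M" using that by (auto simp: matchings_def)
    finally show ?thesis .
  qed
  then have lt: "sum w M < val" if "M \<in> matchings E" for M using w[OF that] that by (simp add: val_def)
  then obtain d where d: "d > 0" "\<And>M. M \<in> matchings E \<Longrightarrow> d \<le> val - sum w M"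
    using finite_positive_lower_bound[OF finite_matchings[OF finE], of "\<lambda>M. val - sum w M"] by auto
  have "val \<ge> d" using d(2)[OF empty] by simp
  \<comment> \<open>The scale lies strictly between the largest matching weight and
    \<open>val\<close>; it is positive because the empty matching has weight 0.\<close>
  define c where "c = val - d / 2"
  have c: "c > 0" "c < val" using d \<open>val \<ge> d\<close> by (auto simp: c_def)
  \<comment> \<open>Negative weights may be cut off: dropping edges leaves a matching, and
    \<open>x\<close> is nonnegative.\<close>
  define w' where "w' = (\<lambda>e. max 0 (w e) / c)"
  have "(\<Sum>e\<in>E. w' e * x e) \<le> 1"
  proof (rule matching_polar_bound[OF V E x0(1) star blossom])
    show "0 \<le> w' e" for e using c by (simp add: w'_def)
    show "sum w' M \<le> 1" if M: "M \<in> matchings E" for M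
    proof -
      define N where "N = {e \<in> M. w e > 0}"
      have "finite M" using M finE by (auto simp: matchings_def intro: finite_subset)
      then have "(\<Sum>e\<in>M. max 0 (w e)) = (\<Sum>e\<in>N. max 0 (w e))"
        by (intro sum.mono_neutral_right) (auto simp: N_def)
      also have "\<dots> = sum w N" by (rule sum.cong) (auto simp: N_def)
      also have "\<dots> \<le> c" using d(2)[of N] d(1) matchings_subset[OF M, of N] by (auto simp: N_def c_def)
      finally show ?thesis using c by (simp add: w'_def flip: sum_divide_distrib)
    qed
  qed
  moreover have "(\<Sum>e\<in>E. w' e * x e) = (\<Sum>e\<in>E. max 0 (w e) * x e) / c"
    by (simp add: w'_def sum_divide_distrib)
  moreover have "val \<le> (\<Sum>e\<in>E. max 0 (w e) * x e)"
    unfolding val_def using x0 by (intro sum_mono mult_right_mono) auto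
  ultimately show False using c by (simp add: pos_divide_le_eq)
qed

section \<open>A moment bound for the size of a random subset\<close>

lemma poly_of_real_add:
  "poly (map_poly complex_of_real (p + q)) z = poly (map_poly of_real p) z + poly (map_poly of_real q) z"
proof -
  have "map_poly complex_of_real (p + q) = map_poly of_real p + map_poly of_real q"
    by (rule poly_eqI) (simp add: coeff_map_poly)
  then show ?thesis by simp
qed

lemma poly_of_real_mult:
  "poly (map_poly complex_of_real (p * q)) z = poly (map_poly of_real p) z * poly (map_poly of_real q) z"
proof (induction p)
  case (pCons a p)
  have "map_poly complex_of_real (smult a q) = smult (of_real a) (map_poly of_real q)"
    by (rule poly_eqI) (simp add: coeff_map_poly)
  moreover have "map_poly complex_of_real (pCons b r) = pCons (of_real b) (map_poly of_real r)" for b r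
    by (simp add: map_poly_pCons)
  ultimately show ?case using pCons by (simp add: poly_of_real_add algebra_simps)
qed simp

text \<open>By continuity. It serves a quotient by \<open>(x - r)^2\<close>, about whose value at
  \<open>r\<close> the product says nothing.\<close>

lemma poly_nonneg_at_point:
  fixes q :: "real poly"
  assumes "\<And>x. x \<noteq> r \<Longrightarrow> 0 \<le> poly q x"
  shows "0 \<le> poly q r"
proof -
  have "((\<lambda>x. poly q x) \<longlongrightarrow> poly q r) (at r)" by (intro tendsto_intros)
  moreover have "eventually (\<lambda>x. 0 \<le> poly q x) (at r)"
    using assms by (auto simp: eventually_at_filter)
  ultimately show ?thesis by (rule tendsto_lowerbound) simp
qed

text \<open>A complex root splits off a factor \<open>(x - \<alpha>)^2 + \<beta>^2\<close>, the
  quotient stays nonnegative, and sums of two squares are closed under products. The degree bounds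
  make the squares admissible tests for a moment matrix of limited order.\<close>

lemma nonneg_poly_sum_of_two_squares:
  fixes p :: "real poly"
  assumes "\<And>x. 0 \<le> poly p x"
  shows "\<exists>a b. p = a ^ 2 + b ^ 2 \<and> 2 * degree a \<le> degree p \<and> 2 * degree b \<le> degree p"
  using assms
proof (induction "degree p" arbitrary: p rule: less_induct)
  case less
  show ?case
  proof (cases "degree p = 0")
    case True
    then obtain c where c: "p = [:c:]" by (rule degree_eq_zeroE)
    then have "c \<ge> 0" using less.prems[of 0] by simp
    then have "p = [:sqrt c:] ^ 2 + 0 ^ 2" using c by (simp add: power2_eq_square)
    then show ?thesis using True by (metis degree_0 degree_pCons_0 le_refl mult_0_right)
  next
    case False
    then have "degree (map_poly complex_of_real p) > 0" by (simp add: degree_map_poly)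
    then obtain z where z: "poly (map_poly complex_of_real p) z = 0"
      using alg_closed_imp_poly_has_root by blast
    define \<alpha> where "\<alpha> = Re z"
    define \<beta> where "\<beta> = Im z"
    define d where "d = [:\<alpha> ^ 2 + \<beta> ^ 2, - 2 * \<alpha>, 1:]"
    have d: "d = [:- \<alpha>, 1:] ^ 2 + [:\<beta>:] ^ 2" by (simp add: d_def power2_eq_square)
    have dz: "poly (map_poly complex_of_real d) z = 0"
      by (simp add: d_def map_poly_pCons \<alpha>_def \<beta>_def complex_eq_iff power2_eq_square algebra_simps)
    have d0: "d \<noteq> 0" "degree d = 2" by (simp_all add: d_def)
    have "\<exists>q. p = d * q \<and> (\<forall>x. 0 \<le> poly q x)"
    proof (cases "\<beta> = 0")
      case \<beta>: False
      \<comment> \<open>The remainder is at most linear, has real coefficients and vanishes at the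
        nonreal \<open>z\<close>; hence it is zero.\<close>
      define r where "r = p mod d"
      have "degree r < 2"
      proof (cases "r = 0")
        case False
        then show ?thesis using degree_mod_less[OF d0(1), of p] d0(2) by (simp add: r_def)
      qed simp
      then have r: "r = [:poly.coeff r 0, poly.coeff r 1:]"
        by (intro poly_eqI) (auto simp: coeff_pCons coeff_eq_0 split: nat.split)
      have p: "p = d * (p div d) + r" by (simp add: r_def)
      have "poly (map_poly complex_of_real p) z = poly (map_poly complex_of_real r) z"
        by (subst p) (simp add: poly_of_real_add poly_of_real_mult dz)
      then have "poly (map_poly complex_of_real [:poly.coeff r 0, poly.coeff r 1:]) z = 0" using z r by simp
      then have e: "complex_of_real (poly.coeff r 0) + z * complex_of_real (poly.coeff r 1) = 0"
        by (simp add: map_poly_pCons)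
      from arg_cong[OF e, of Im] have "poly.coeff r 1 = 0" using \<beta> by (simp add: \<beta>_def)
      moreover from arg_cong[OF e, of Re] this have "poly.coeff r 0 = 0" by simp
      ultimately have "r = 0" using r by simp
      then have pd: "p = d * (p div d)" using p by simp
      have "0 \<le> poly (p div d) x" for x
      proof -
        have "poly d x = (x - \<alpha>)^2 + \<beta>^2" by (simp add: d power2_eq_square algebra_simps)
        then have "poly d x > 0" using \<beta> by (simp add: add_nonneg_pos)
        moreover have "0 \<le> poly d x * poly (p div d) x"
          using less.prems[of x] by (subst (asm) pd) simp
        ultimately show ?thesis by (simp add: zero_le_mult_iff)
      qed
      then show ?thesis using pd by blast
    next
      case \<beta>: True
      then have "z = of_real \<alpha>" by (simp add: \<alpha>_def \<beta>_def complex_eq_iff)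
      moreover have "poly (map_poly complex_of_real p) (of_real x) = of_real (poly p x)" for x
        by (induction p) (auto simp: map_poly_pCons)
      ultimately have root: "poly p \<alpha> = 0" using z by simp
      then obtain q1 where q1: "p = [:- \<alpha>, 1:] * q1" by (metis dvdE poly_eq_0_iff_dvd)
      \<comment> \<open>A real root of a nonnegative polynomial is a minimum, so its multiplicity is
        at least two.\<close>
      have "poly (pderiv p) \<alpha> = 0"
        by (rule DERIV_local_min[OF poly_DERIV, of 1]) (use less.prems root in auto)
      then have "poly q1 \<alpha> = 0" unfolding q1 pderiv_mult by (simp add: pderiv_pCons del: mult_pCons_left)
      then obtain q where q: "q1 = [:- \<alpha>, 1:] * q" by (metis dvdE poly_eq_0_iff_dvd)
      have pd: "p = d * q" unfolding q1 q d using \<beta> by (simp add: power2_eq_square mult.assoc del: mult_pCons_left)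
      have "0 \<le> poly q x" if "x \<noteq> \<alpha>" for x
      proof -
        have "poly d x = (x - \<alpha>)^2" using \<beta> by (simp add: d power2_eq_square algebra_simps)
        then have "poly d x > 0" using that by simp
        moreover have "0 \<le> poly d x * poly q x"
          using less.prems[of x] by (simp add: pd)
        ultimately show ?thesis by (simp add: zero_le_mult_iff)
      qed
      then have "\<forall>x. 0 \<le> poly q x" using poly_nonneg_at_point by metis
      then show ?thesis using pd by blast
    qed
    then obtain q where q: "p = d * q" "\<And>x. 0 \<le> poly q x" by blast
    have "q \<noteq> 0" using q False by auto
    then have deg: "degree p = degree q + 2" using d0 by (simp add: q degree_mult_eq)
    obtain a b where ab: "q = a ^ 2 + b ^ 2" "2 * degree a \<le> degree q" "2 * degree b \<le> degree q"
      using less.hyps[of q] deg q by auto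
    \<comment> \<open>The two-square identity, that is, multiplicativity of the complex
      norm.\<close>
    define a' where "a' = [:- \<alpha>, 1:] * a - [:\<beta>:] * b"
    define b' where "b' = [:- \<alpha>, 1:] * b + [:\<beta>:] * a"
    have "p = a' ^ 2 + b' ^ 2"
      unfolding q(1) d ab(1) a'_def b'_def by (simp only: power2_eq_square) algebra
    moreover have "degree ([:u, v:] * f) \<le> degree f + 1" for u v and f :: "real poly"
      by (rule order_trans[OF degree_mult_le]) simp
    moreover have "degree ([:u:] * f) \<le> degree f" for u and f :: "real poly"
      by (simp add: degree_smult_le)
    ultimately have *: "p = a' ^ 2 + b' ^ 2"
      "degree ([:- \<alpha>, 1:] * f) \<le> degree f + 1" "degree ([:\<beta>:] * f) \<le> degree f" for f :: "real poly"
      by blast+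
    define k where "k = degree p div 2"
    have k: "degree a + 1 \<le> k" "degree b + 1 \<le> k" using ab deg by (auto simp: k_def)
    have "degree a' \<le> k" "degree b' \<le> k"
      unfolding a'_def b'_def using *(2,3)[of a] *(2,3)[of b] k
      by (auto intro!: degree_diff_le degree_add_le simp del: mult_pCons_left)
    then show ?thesis using *(1) by (intro exI[of _ a'] exI[of _ b']) (auto simp: k_def)
  qed
qed

text \<open>The last factor has absolute value at most 1 until \<open>x\<close> passes the last
  index. On the remaining unit interval each factor is compared with its value at the right end,
  where the product is a quotient of equal factorials.\<close>

lemma abs_prod_one_minus_le_1:
  fixes x :: real
  assumes "0 \<le> x" "x \<le> real N + 1"
  shows "\<bar>\<Prod>l\<in>{1..N}. 1 - x / real l\<bar> \<le> 1"
  using assms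
proof (induction N)
  case (Suc N)
  show ?case
  proof (cases "x \<le> real N + 1")
    case True
    then have "\<bar>1 - x / real (Suc N)\<bar> \<le> 1" using Suc.prems by (simp add: field_simps)
    then have "\<bar>\<Prod>l\<in>{1..N}. 1 - x / real l\<bar> * \<bar>1 - x / real (Suc N)\<bar> \<le> 1"
      using Suc.IH[OF Suc.prems(1) True] by (intro mult_le_one) auto
    then show ?thesis by (simp add: abs_mult)
  next
    case False
    have "\<bar>\<Prod>l\<in>{1..Suc N}. 1 - x / real l\<bar> = (\<Prod>l\<in>{1..Suc N}. \<bar>1 - x / real l\<bar>)"
      by (rule abs_prod)
    also have "\<dots> \<le> (\<Prod>l\<in>{1..Suc N}. real (1 + Suc N - l) / real l)"
    proof (rule prod_mono)
      fix l assume l: "l \<in> {1..Suc N}"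
      then have "real (1 + Suc N - l) = real N + 2 - real l" by (simp add: of_nat_diff)
      moreover have "\<bar>1 - x / real l\<bar> = (x - real l) / real l"
        using l False by (auto simp: field_simps abs_if)
      ultimately show "0 \<le> \<bar>1 - x / real l\<bar> \<and> \<bar>1 - x / real l\<bar> \<le> real (1 + Suc N - l) / real l"
        using l Suc.prems by (auto intro!: divide_right_mono)
    qed
    also have "\<dots> = (\<Prod>l\<in>{1..Suc N}. real (1 + Suc N - l)) / (\<Prod>l\<in>{1..Suc N}. real l)"
      by (rule prod_dividef)
    also have "(\<Prod>l\<in>{1..Suc N}. real (1 + Suc N - l)) = (\<Prod>l\<in>{1..Suc N}. real l)"
      using prod.atLeastAtMost_rev[of real 1 "Suc N"] by simp
    finally show ?thesis by (simp add: prod_zero_iff)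
  qed
qed simp

text \<open>Left of 0 all factors are at least 1; beyond \<open>N + 1\<close> all are negative, and
  their odd number makes the product negative.\<close>

lemma one_minus_prod_nonneg:
  fixes x :: real
  assumes "odd N"
  shows "0 \<le> x * (1 - (\<Prod>l\<in>{1..N}. 1 - x / real l))" (is "0 \<le> x * (1 - ?P)")
proof -
  consider "x < 0" | "0 \<le> x" "x \<le> real N + 1" | "real N + 1 < x" by linarith
  then show ?thesis
  proof cases
    case 1
    then have "1 \<le> ?P" by (intro prod_ge_1) (simp add: divide_nonpos_nonneg)
    then show ?thesis using 1 by (simp add: mult_nonpos_nonpos)
  next
    case 2
    then show ?thesis using abs_prod_one_minus_le_1[OF 2] by (intro mult_nonneg_nonneg) auto
  next
    case 3
    have "?P = (\<Prod>l\<in>{1..N}. - (x / real l - 1))" by simp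
    also have "\<dots> = - (\<Prod>l\<in>{1..N}. x / real l - 1)"
      using assms by (subst prod_uminus) simp
    also have "\<dots> \<le> 0" using 3 by (auto intro!: prod_nonneg simp: field_simps)
    finally show ?thesis using 3 by (intro mult_nonneg_nonneg) auto
  qed
qed

lemma identity_on_initial_segment_sum_of_squares:
  assumes "odd N"
  obtains a b :: "real poly" where "2 * degree a \<le> N + 1" "2 * degree b \<le> N + 1"
    "\<And>i. i \<le> N \<Longrightarrow> (poly a (real i))^2 + (poly b (real i))^2 = real i"
proof -
  define P where "P = (\<Prod>l\<in>{1..N}. [:1, - 1 / real l:])"
  \<comment> \<open>At \<open>i = 0\<close> the leading factor vanishes, at
    \<open>1 \<le> i \<le> N\<close> the product \<open>P\<close> does; either way the value is
    \<open>i\<close>.\<close>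
  define s where "s = [:0, 1:] * (1 - P)"
  have P: "poly P x = (\<Prod>l\<in>{1..N}. 1 - x / real l)" for x by (simp add: P_def poly_prod)
  have "degree P \<le> (\<Sum>l\<in>{1..N}. degree [:1, - 1 / real l:])"
    unfolding P_def by (rule degree_prod_sum_le[unfolded comp_def]) simp
  also have "\<dots> \<le> (\<Sum>l\<in>{1..N}. 1)" by (rule sum_mono) simp
  finally have "degree (1 - P) \<le> N" by (intro degree_diff_le) auto
  then have deg: "degree s \<le> N + 1"
    unfolding s_def by (intro order_trans[OF degree_mult_le]) simp
  have "0 \<le> poly s x" for x
    using one_minus_prod_nonneg[OF assms, of x] by (simp add: s_def P)
  then obtain a b where ab: "s = a ^ 2 + b ^ 2" "2 * degree a \<le> degree s" "2 * degree b \<le> degree s"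
    using nonneg_poly_sum_of_two_squares by blast
  have "poly s (real i) = real i" if "i \<le> N" for i
  proof (cases "i = 0")
    case False
    then have "(\<Prod>l\<in>{1..N}. 1 - real i / real l) = 0"
      using that by (intro prod_zero) (auto intro!: bexI[of _ i])
    then show ?thesis by (simp add: s_def P)
  qed (simp add: s_def)
  then show ?thesis using that[of a b] ab deg by (simp add: power2_eq_square)
qed

section \<open>Polynomials of a cardinality as subset sums, and Moebius inversion\<close>

lemma poly_binomial_basis:
  fixes q :: "real poly"
  assumes "degree q \<le> d"
  shows "\<exists>\<gamma>. \<forall>N. poly q (real N) = (\<Sum>j\<le>d. \<gamma> j * real (N choose j))"
  using assms
proof (induction d arbitrary: q)
  case 0
  then obtain c where "q = [:c:]" by (metis degree_eq_zeroE le_zero_eq)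
  then show ?case by (intro exI[of _ "\<lambda>_. c"]) simp
next
  case (Suc d)
  obtain a r where q: "q = pCons a r" by (rule pCons_cases)
  then have "degree r \<le> d" using Suc.prems by (cases "r = 0") auto
  then obtain \<gamma> where \<gamma>: "\<And>N. poly r (real N) = (\<Sum>j\<le>d. \<gamma> j * real (N choose j))"
    using Suc.IH by blast
  have absorb: "real N * real (N choose j) = real j * real (N choose j) + real (Suc j) * real (N choose Suc j)" for N j
  proof (cases "j \<le> N")
    case True
    have "(N - j) * (N choose j) = Suc j * (N choose Suc j)"
      by (simp only: binomial_absorb_comp binomial_absorption)
    then have "real (N - j) * real (N choose j) = real (Suc j) * real (N choose Suc j)"
      by (metis of_nat_mult)
    then show ?thesis using True by (simp add: of_nat_diff algebra_simps)
  qed (simp add: binomial_eq_0)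
  \<comment> \<open>From \<open>q = a + x * r\<close>: the constant contributes at
    \<open>j = 0\<close>, and \<open>absorb\<close> sends each \<open>\<gamma> j\<close> to the
    positions \<open>j\<close> and \<open>j + 1\<close>.\<close>
  define \<gamma>' where "\<gamma>' = (\<lambda>j. (if j = 0 then a else 0) + (if j \<le> d then real j * \<gamma> j else 0)
      + (if j = 0 then 0 else real j * \<gamma> (j - 1)))"
  have "poly q (real N) = (\<Sum>j\<le>Suc d. \<gamma>' j * real (N choose j))" for N
  proof -
    have "(\<Sum>j\<le>Suc d. \<gamma>' j * real (N choose j))
        = (\<Sum>j\<le>Suc d. (if j = 0 then a else 0)) +
          (\<Sum>j\<le>Suc d. if j \<le> d then real j * \<gamma> j * real (N choose j) else 0) +
          (\<Sum>j\<le>Suc d. if j = 0 then 0 else real j * \<gamma> (j - 1) * real (N choose j))"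
      unfolding sum.distrib[symmetric] by (rule sum.cong) (auto simp: \<gamma>'_def algebra_simps)
    also have "(\<Sum>j\<le>Suc d. (if j = 0 then a else 0)) = a" by (subst sum.delta) auto
    also have "(\<Sum>j\<le>Suc d. if j \<le> d then real j * \<gamma> j * real (N choose j) else 0)
        = (\<Sum>j\<le>d. real j * \<gamma> j * real (N choose j))" by simp
    also have "(\<Sum>j\<le>Suc d. if j = 0 then 0 else real j * \<gamma> (j - 1) * real (N choose j))
        = (\<Sum>j\<le>d. real (Suc j) * \<gamma> j * real (N choose Suc j))"
      by (subst sum.atMost_Suc_shift) simp
    also have "a + (\<Sum>j\<le>d. real j * \<gamma> j * real (N choose j))
        + (\<Sum>j\<le>d. real (Suc j) * \<gamma> j * real (N choose Suc j))
        = a + (\<Sum>j\<le>d. \<gamma> j * (real N * real (N choose j)))"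
      unfolding absorb by (simp add: sum.distrib algebra_simps)
    also have "\<dots> = poly q (real N)"
      by (simp add: q \<gamma> sum_distrib_left mult.left_commute)
    finally show ?thesis by simp
  qed
  then show ?case by blast
qed

text \<open>\<open>N choose j\<close> counts subsets of size \<open>j\<close>. The coefficients
  \<open>c\<close> do not depend on \<open>M\<close>, so they form a vector with which a moment
  matrix can be tested.\<close>

lemma poly_card_as_subset_sum:
  fixes q :: "real poly"
  assumes "degree q \<le> d"
  obtains c where "\<And>M :: 'a set. finite M \<Longrightarrow>
    (\<Sum>S\<in>{S. S \<subseteq> M \<and> card S \<le> d}. c S) = poly q (real (card M))"
proof -
  obtain \<gamma> where \<gamma>: "\<And>N. poly q (real N) = (\<Sum>j\<le>d. \<gamma> j * real (N choose j))"
    using poly_binomial_basis[OF assms] by blast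
  have "(\<Sum>S\<in>{S. S \<subseteq> M \<and> card S \<le> d}. \<gamma> (card S)) = poly q (real (card M))"
    if M: "finite M" for M :: "'a set"
  proof -
    have "(\<Sum>S\<in>{S. S \<subseteq> M \<and> card S \<le> d}. \<gamma> (card S))
      = (\<Sum>j\<le>d. \<Sum>S\<in>{S \<in> {S. S \<subseteq> M \<and> card S \<le> d}. card S = j}. \<gamma> (card S))"
      by (rule sum.group[symmetric]) (use M in auto)
    also have "\<dots> = (\<Sum>j\<le>d. \<gamma> j * real (card M choose j))"
    proof (rule sum.cong)
      fix j assume "j \<in> {..d}"
      then have "{S \<in> {S. S \<subseteq> M \<and> card S \<le> d}. card S = j} = {S. S \<subseteq> M \<and> card S = j}" by auto
      then show "(\<Sum>S\<in>{S \<in> {S. S \<subseteq> M \<and> card S \<le> d}. card S = j}. \<gamma> (card S))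
          = \<gamma> j * real (card M choose j)"
        using n_subsets[OF M, of j] by simp
    qed simp
    finally show ?thesis by (simp add: \<gamma>)
  qed
  then show ?thesis using that[of "\<lambda>S. \<gamma> (card S)"] by blast
qed

text \<open>Inclusion-exclusion, carried over to supersets by complementation in \<open>G\<close>.
  The weight \<open>z\<close> may be negative; since \<open>z M\<close> involves \<open>y\<close>
  only at supersets of \<open>M\<close>, it vanishes when \<open>y\<close> does there.\<close>

lemma superset_moebius:
  fixes y :: "'a set \<Rightarrow> real"
  assumes G: "finite G"
  obtains z where "\<And>R. R \<subseteq> G \<Longrightarrow> y R = (\<Sum>M\<in>{M. R \<subseteq> M \<and> M \<subseteq> G}. z M)"
    and "\<And>M. (\<And>R. M \<subseteq> R \<Longrightarrow> R \<subseteq> G \<Longrightarrow> y R = 0) \<Longrightarrow> M \<subseteq> G \<Longrightarrow> z M = 0"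
proof -
  define g where "g = (\<lambda>S. \<Sum>T\<in>Pow S. (-1) ^ card T * y (G - T))"
  define z where "z = (\<lambda>M. (-1) ^ card (G - M) * g (G - M))"
  have "y R = (\<Sum>M\<in>{M. R \<subseteq> M \<and> M \<subseteq> G}. z M)" if R: "R \<subseteq> G" for R
  proof -
    have "y (G - (G - R)) = (\<Sum>T\<in>Pow (G - R). (-1) ^ card T * g T)"
      by (rule inclusion_exclusion_symmetric[where f = "\<lambda>T. y (G - T)"]) (use G in \<open>auto simp: g_def\<close>)
    also have "\<dots> = (\<Sum>M\<in>{M. R \<subseteq> M \<and> M \<subseteq> G}. z M)"
      by (rule sum.reindex_bij_witness[of _ "\<lambda>M. G - M" "\<lambda>T. G - T"])
        (use R double_diff[of _ G G] in \<open>auto simp: z_def Diff_Diff_Int Int_absorb1 subset_iff\<close>)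
    finally show ?thesis using R by (simp add: double_diff)
  qed
  moreover have "z M = 0" if "\<And>R. M \<subseteq> R \<Longrightarrow> R \<subseteq> G \<Longrightarrow> y R = 0" "M \<subseteq> G" for M
  proof -
    have "y (G - T) = 0" if "T \<subseteq> G - M" for T
      using \<open>M \<subseteq> G\<close> that by (intro \<open>\<And>R. M \<subseteq> R \<Longrightarrow> R \<subseteq> G \<Longrightarrow> y R = 0\<close>) auto
    then show ?thesis by (simp add: z_def g_def)
  qed
  ultimately show ?thesis using that by blast
qed

text \<open>Moebius inversion turns \<open>y\<close> into a signed weight \<open>z\<close> on the subsets of size at most \<open>m\<close>, for
  which the squares of polynomials of degree at most \<open>t\<close> in the size have nonnegative integral; the
  slack \<open>m - card M\<close> is a sum of two such squares.\<close>

lemma moment_cardinality_bound: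
  fixes y :: "'a set \<Rightarrow> real"
  assumes G: "finite G"
    and psd: "\<And>c. 0 \<le> (\<Sum>S\<in>{S. S \<subseteq> G \<and> card S \<le> t}. \<Sum>S'\<in>{S. S \<subseteq> G \<and> card S \<le> t}. c S * y (S \<union> S') * c S')"
    and y1: "y {} = 1"
    and y0: "\<And>R. R \<subseteq> G \<Longrightarrow> m < card R \<Longrightarrow> card R \<le> 2 * t \<Longrightarrow> y R = 0"
    and N: "odd N" "m \<le> N" "N + 1 \<le> 2 * t"
  shows "(\<Sum>e\<in>G. y {e}) \<le> real m"
proof -
  \<comment> \<open>Vanishing of \<open>y\<close> is known only up to size \<open>2 * t\<close>. The
    cut above \<open>m\<close> changes nothing in that range and confines \<open>z\<close> to sets
    of size at most \<open>m\<close>.\<close>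
  define y' where "y' = (\<lambda>R. if card R \<le> m then y R else 0)"
  have y': "y' R = y R" if "R \<subseteq> G" "card R \<le> 2 * t" for R
    using y0[of R] that by (auto simp: y'_def)
  obtain z where z: "\<And>R. R \<subseteq> G \<Longrightarrow> y' R = (\<Sum>M\<in>{M. R \<subseteq> M \<and> M \<subseteq> G}. z M)"
    and z0': "\<And>M. (\<And>R. M \<subseteq> R \<Longrightarrow> R \<subseteq> G \<Longrightarrow> y' R = 0) \<Longrightarrow> M \<subseteq> G \<Longrightarrow> z M = 0"
    by (rule superset_moebius[OF G, of y']) blast
  have z0: "z M = 0" if "M \<subseteq> G" "card M > m" for M
  proof (rule z0')
    fix R assume "M \<subseteq> R" "R \<subseteq> G"
    then have "card M \<le> card R" using G by (meson card_mono finite_subset)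
    then show "y' R = 0" using that by (simp add: y'_def)
  qed fact
  define T where "T = {S. S \<subseteq> G \<and> card S \<le> t}"
  have finT: "finite T" using G by (simp add: T_def)
  have finM: "finite M" if "M \<subseteq> G" for M using G that finite_subset by blast
  have swap: "(\<Sum>R\<in>A. \<Sum>M\<in>{M. f R \<subseteq> M \<and> M \<subseteq> G}. h R M) = (\<Sum>M\<in>Pow G. \<Sum>R\<in>{R \<in> A. f R \<subseteq> M}. h R M)"
    if "finite A" for A :: "'b set" and f :: "'b \<Rightarrow> 'a set" and h :: "'b \<Rightarrow> 'a set \<Rightarrow> real"
  proof -
    have "(\<Sum>M\<in>{M. f R \<subseteq> M \<and> M \<subseteq> G}. h R M) = (\<Sum>M\<in>Pow G. if f R \<subseteq> M then h R M else 0)" for R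
      using G by (intro sum.mono_neutral_cong_left) auto
    moreover have "(\<Sum>R\<in>{R \<in> A. f R \<subseteq> M}. h R M) = (\<Sum>R\<in>A. if f R \<subseteq> M then h R M else 0)" for M
      using that by (intro sum.mono_neutral_cong_left) auto
    ultimately show ?thesis by (simp add: sum.swap[of _ A])
  qed
  \<comment> \<open>With \<open>c\<close> encoding \<open>q\<close>, expressing \<open>y\<close>
    through \<open>z\<close> and exchanging the sums turns the quadratic form into a
    \<open>z\<close>-weighted sum of squares.\<close>
  have square: "0 \<le> (\<Sum>M\<in>Pow G. z M * (poly q (real (card M)))^2)" if "degree q \<le> t" for q :: "real poly"
  proof -
    obtain c where c: "\<And>M :: 'a set. finite M \<Longrightarrow>
        (\<Sum>S\<in>{S. S \<subseteq> M \<and> card S \<le> t}. c S) = poly q (real (card M))"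
      by (rule poly_card_as_subset_sum[OF \<open>degree q \<le> t\<close>]) blast
    have "(\<Sum>S\<in>T. \<Sum>S'\<in>T. c S * y (S \<union> S') * c S')
        = (\<Sum>p\<in>T \<times> T. \<Sum>M\<in>{M. fst p \<union> snd p \<subseteq> M \<and> M \<subseteq> G}. c (fst p) * z M * c (snd p))"
      unfolding sum.cartesian_product
    proof (rule sum.cong)
      fix p assume p: "p \<in> T \<times> T"
      then have "card (fst p \<union> snd p) \<le> 2 * t"
        by (auto simp: T_def intro: order_trans[OF card_Un_le])
      then have "y (fst p \<union> snd p) = (\<Sum>M\<in>{M. fst p \<union> snd p \<subseteq> M \<and> M \<subseteq> G}. z M)"
        using y'[of "fst p \<union> snd p"] z[of "fst p \<union> snd p"] p by (auto simp: T_def)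
      then show "(case p of (S, S') \<Rightarrow> c S * y (S \<union> S') * c S')
          = (\<Sum>M\<in>{M. fst p \<union> snd p \<subseteq> M \<and> M \<subseteq> G}. c (fst p) * z M * c (snd p))"
        by (simp add: case_prod_beta sum_distrib_left sum_distrib_right)
    qed simp
    also have "\<dots> = (\<Sum>M\<in>Pow G. \<Sum>p\<in>{p \<in> T \<times> T. fst p \<union> snd p \<subseteq> M}. c (fst p) * z M * c (snd p))"
      by (rule swap) (use finT in simp)
    also have "\<dots> = (\<Sum>M\<in>Pow G. z M * (poly q (real (card M)))^2)"
    proof (rule sum.cong)
      fix M assume M: "M \<in> Pow G"
      have "{p \<in> T \<times> T. fst p \<union> snd p \<subseteq> M}
          = {S. S \<subseteq> M \<and> card S \<le> t} \<times> {S. S \<subseteq> M \<and> card S \<le> t}"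
        using M by (auto simp: T_def)
      then have "(\<Sum>p\<in>{p \<in> T \<times> T. fst p \<union> snd p \<subseteq> M}. c (fst p) * z M * c (snd p))
          = (\<Sum>S\<in>{S. S \<subseteq> M \<and> card S \<le> t}. \<Sum>S'\<in>{S. S \<subseteq> M \<and> card S \<le> t}. c S * z M * c S')"
        by (simp add: sum.cartesian_product case_prod_beta)
      also have "\<dots> = z M * ((\<Sum>S\<in>{S. S \<subseteq> M \<and> card S \<le> t}. c S) * (\<Sum>S'\<in>{S. S \<subseteq> M \<and> card S \<le> t}. c S'))"
        unfolding sum_product by (simp add: sum_distrib_left mult_ac)
      finally show "(\<Sum>p\<in>{p \<in> T \<times> T. fst p \<union> snd p \<subseteq> M}. c (fst p) * z M * c (snd p))
          = z M * (poly q (real (card M)))^2"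
        using c finM M by (simp add: power2_eq_square)
    qed simp
    finally show ?thesis using psd[of c] by (simp add: T_def)
  qed
  obtain a b :: "real poly" where ab: "2 * degree a \<le> N + 1" "2 * degree b \<le> N + 1"
    "\<And>i. i \<le> N \<Longrightarrow> (poly a (real i))^2 + (poly b (real i))^2 = real i"
    by (rule identity_on_initial_segment_sum_of_squares[OF N(1)]) blast
  \<comment> \<open>The two squares represent the identity at the slack, so the argument is
    \<open>m - x\<close> with \<open>x\<close> the cardinality; degrees are unchanged.\<close>
  define rev_poly where "rev_poly = (\<lambda>p :: real poly. pcompose p [:real m, -1:])"
  have "degree (rev_poly a) \<le> t" "degree (rev_poly b) \<le> t"
    using ab N by (simp_all add: rev_poly_def degree_pcompose)
  then have "0 \<le> (\<Sum>M\<in>Pow G. z M * (poly (rev_poly a) (real (card M)))^2)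
      + (\<Sum>M\<in>Pow G. z M * (poly (rev_poly b) (real (card M)))^2)"
    using square by (intro add_nonneg_nonneg)
  also have "\<dots> = (\<Sum>M\<in>Pow G. z M * (real m - real (card M)))"
    unfolding sum.distrib[symmetric]
  proof (rule sum.cong)
    fix M assume M: "M \<in> Pow G"
    show "z M * (poly (rev_poly a) (real (card M)))^2 + z M * (poly (rev_poly b) (real (card M)))^2
        = z M * (real m - real (card M))"
    proof (cases "card M \<le> m")
      case True
      then have "real m - real (card M) = real (m - card M)" by (simp add: of_nat_diff)
      then have "(poly (rev_poly a) (real (card M)))^2 + (poly (rev_poly b) (real (card M)))^2
          = real m - real (card M)"
      proof -
        have "m - card M \<le> N" using N by simp
        note ab(3)[OF this, folded \<open>real m - real (card M) = real (m - card M)\<close>]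
        then show ?thesis unfolding rev_poly_def poly_pcompose by simp
      qed
      then show ?thesis by (simp only: distrib_left[symmetric])
    qed (use z0 M in simp)
  qed simp
  also have "\<dots> = real m * (\<Sum>M\<in>Pow G. z M) - (\<Sum>M\<in>Pow G. \<Sum>e\<in>{e \<in> G. {e} \<subseteq> M}. z M)"
  proof -
    have "(\<Sum>M\<in>Pow G. \<Sum>e\<in>{e \<in> G. {e} \<subseteq> M}. z M) = (\<Sum>M\<in>Pow G. z M * real (card M))"
    proof (rule sum.cong)
      fix M assume "M \<in> Pow G"
      then have "{e \<in> G. {e} \<subseteq> M} = M" by auto
      then show "(\<Sum>e\<in>{e \<in> G. {e} \<subseteq> M}. z M) = z M * real (card M)" by simp
    qed simp
    then show ?thesis by (simp add: right_diff_distrib sum_subtractf sum_distrib_left mult.commute)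
  qed
  also have "(\<Sum>M\<in>Pow G. \<Sum>e\<in>{e \<in> G. {e} \<subseteq> M}. z M) = (\<Sum>e\<in>G. y {e})"
  proof -
    have "(\<Sum>M\<in>Pow G. \<Sum>e\<in>{e \<in> G. {e} \<subseteq> M}. z M) = (\<Sum>e\<in>G. \<Sum>M\<in>{M. {e} \<subseteq> M \<and> M \<subseteq> G}. z M)"
      using swap[OF G, of "\<lambda>e. z" "\<lambda>e. {e}"] by simp
    also have "\<dots> = (\<Sum>e\<in>G. y {e})"
    proof (rule sum.cong)
      fix e assume "e \<in> G"
      then show "(\<Sum>M\<in>{M. {e} \<subseteq> M \<and> M \<subseteq> G}. z M) = y {e}"
        using z[of "{e}"] y'[of "{e}"] N by simp
    qed simp
    finally show ?thesis .
  qed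
  also have "(\<Sum>M\<in>Pow G. z M) = 1"
    using z[of "{}"] y1 by (simp add: y'_def Pow_def)
  finally show ?thesis by simp
qed

section \<open>Integer points give feasible matrices\<close>

lemma finite_zero_one:
  assumes "finite C"
  shows "finite (zero_one C)"
proof -
  have "inj_on (\<lambda>z. {i \<in> C. z i = 1}) (zero_one C)"
  proof (rule inj_onI, rule ext)
    fix z z' i
    assume "z \<in> zero_one C" "z' \<in> zero_one C" "{i \<in> C. z i = 1} = {i \<in> C. z' i = 1}"
    note z = this
    show "z i = z' i"
    proof (cases "i \<in> C")
      case True
      then have "z i = 1 \<longleftrightarrow> z' i = 1" using z(3) by blast
      moreover have "z i = 0 \<or> z i = 1" "z' i = 0 \<or> z' i = 1"
        using z(1,2) True unfolding zero_one_def by blast+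
      ultimately show ?thesis by argo
    next
      case False
      then show ?thesis using z(1,2) by (simp add: zero_one_def)
    qed
  qed
  moreover have "finite ((\<lambda>z. {i \<in> C. z i = 1}) ` zero_one C)"
    by (rule finite_subset[of _ "Pow C"]) (use assms in auto)
  ultimately show ?thesis by (rule finite_imageD[rotated])
qed

lemma sum_of_bool_le_card_minus_1:
  assumes "finite A" "i \<in> A" "\<not> P i"
  shows "(\<Sum>i\<in>A. of_bool (P i) :: real) \<le> real (card A) - 1"
proof -
  have "(\<Sum>i\<in>A. of_bool (P i) :: real) = (\<Sum>i\<in>A - {i}. of_bool (P i))"
    by (subst sum.remove[OF assms(1,2)]) (simp only: assms(3) of_bool_eq add_0)
  also have "\<dots> \<le> (\<Sum>i\<in>A - {i}. 1)" by (rule sum_mono) simp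
  also have "\<dots> = real (card A) - 1"
  proof -
    have "card A \<ge> 1" using assms by (metis One_nat_def Suc_leI card_gt_0_iff empty_iff)
    then show ?thesis using assms by (simp add: card_Diff_singleton of_nat_diff)
  qed
  finally show ?thesis .
qed

text \<open>The column is that of the unit mass at \<open>z\<close>. In the last inequality, once
  one of the prescribed values fails, at most \<open>card S + card T - 1\<close> of them
  hold.\<close>

lemma column_cond2_point:
  assumes C: "finite C" and z: "z \<in> zero_one C" and ST: "S \<subseteq> C" "T \<subseteq> C"
  shows "column_cond2 C (\<lambda>\<alpha>. of_bool (z \<in> \<alpha>)) S T"
proof -
  have fx: "z \<in> fix_at C A t \<longleftrightarrow> (\<forall>i\<in>A. z i = t)" for A t using z by (simp add: fix_at_def)
  have fin: "finite S" "finite T" using C ST finite_subset by auto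
  have "(\<Sum>i\<in>S. of_bool (z i = 1)) + (\<Sum>i\<in>T. of_bool (z i = 0))
      - of_bool ((\<forall>i\<in>S. z i = 1) \<and> (\<forall>i\<in>T. z i = 0)) \<le> real (card S) + real (card T) - 1"
  proof (cases "(\<forall>i\<in>S. z i = 1) \<and> (\<forall>i\<in>T. z i = 0)")
    case False
    then consider i where "i \<in> S" "z i \<noteq> 1" | i where "i \<in> T" "z i \<noteq> 0" by blast
    moreover have "(\<Sum>i\<in>A. of_bool (z i = t) :: real) \<le> real (card A)" for A and t :: real
      by (rule order_trans[OF sum_mono[where g = "\<lambda>_. 1"]]) auto
    note le = this[of 1 S] this[of 0 T]
    ultimately show ?thesis
    proof cases
      case (1 i)
      show ?thesis
        using sum_of_bool_le_card_minus_1[of S i "\<lambda>i. z i = 1", OF fin(1) 1] le False by (simp only: of_bool_eq)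
    next
      case (2 i)
      show ?thesis
        using sum_of_bool_le_card_minus_1[of T i "\<lambda>i. z i = 0", OF fin(2) 2] le False by (simp only: of_bool_eq)
    qed
  qed simp
  then show ?thesis
    unfolding column_cond2_def Let_def
  proof (intro conjI ballI)
    fix i assume i: "i \<in> T"
    then have "z i = 0 \<or> z i = 1" using z ST by (auto simp: zero_one_def)
    then show "of_bool (z \<in> fix_at C S 1 \<inter> fix_at C T 0)
        + of_bool (z \<in> fix_at C (S \<union> {i}) 1 \<inter> fix_at C (T - {i}) 0)
        = (of_bool (z \<in> fix_at C S 1 \<inter> fix_at C (T - {i}) 0) :: real)"
      using i by (elim disjE) (auto simp: fx)
  qed (use z in \<open>auto simp: fx\<close>)
qed

text \<open>At most one \<open>U'\<close> contributes to the sum: the set \<open>U1\<close> of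
  coordinates in \<open>U\<close> where \<open>z\<close> is 1. It is in range exactly when
  \<open>z\<close> misses the threshold.\<close>

lemma column_cond3_point:
  assumes C: "finite C" and z: "z \<in> zero_one C" and STU: "S \<subseteq> C" "T \<subseteq> C" "U \<subseteq> C"
    and disj: "S \<inter> T = {}" "S \<inter> U = {}" "T \<inter> U = {}"
  shows "column_cond3 C (\<lambda>\<alpha>. of_bool (z \<in> \<alpha>)) S T U r"
proof -
  have fx: "z \<in> fix_at C A t \<longleftrightarrow> (\<forall>i\<in>A. z i = t)" for A t using z by (simp add: fix_at_def)
  have finU: "finite U" using C STU(3) by (rule rev_finite_subset)
  have zU: "z i = 0 \<or> z i = 1" if "i \<in> U" for i using that STU z by (auto simp: zero_one_def)
  then have z01: "z i = of_bool (z i = 1)" "z i = 1 - of_bool (z i = 0)" if "i \<in> U" for i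
    using that by fastforce+
  define U1 where "U1 = {i \<in> U. z i = 1}"
  have sumU: "(\<Sum>i\<in>U. z i) = real (card U1)"
  proof -
    have "(\<Sum>i\<in>U. z i) = (\<Sum>i\<in>U. of_bool (z i = 1))" by (rule sum.cong) (use z01 in auto)
    also have "\<dots> = real (card U1)"
      using finU by (simp add: U1_def Int_def)
    finally show ?thesis .
  qed
  have fewer: "z \<in> fewer_than C U r \<longleftrightarrow> card U1 < r"
    using z sumU by (auto simp: fewer_than_def)
  have c3: "(real (card U) - (real r - 1)) * of_bool ((\<forall>i\<in>S. z i = 1) \<and> (\<forall>i\<in>T. z i = 0) \<and> card U1 < r)
      \<le> (\<Sum>i\<in>U. of_bool (z i = 0))"
  proof (cases "card U1 < r")
    case True
    have "(\<Sum>i\<in>U. z i) = (\<Sum>i\<in>U. 1 - of_bool (z i = 0))" by (rule sum.cong) (use z01 in auto)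
    then have "(\<Sum>i\<in>U. of_bool (z i = 0)) = real (card U) - real (card U1)"
      using sumU by (simp add: sum_subtractf)
    moreover have "real (card U1) \<le> real (card U)" using finU by (simp add: U1_def card_mono)
    ultimately show ?thesis using True by (auto simp: of_bool_def)
  qed (simp add: sum_nonneg)
  have c4: "of_bool ((\<forall>i\<in>S. z i = 1) \<and> (\<forall>i\<in>T. z i = 0) \<and> card U1 < r)
      = of_bool ((\<forall>i\<in>S. z i = 1) \<and> (\<forall>i\<in>T. z i = 0))
        - (\<Sum>U'\<in>{U'. U' \<subseteq> U \<and> card U' \<ge> r}.
            of_bool ((\<forall>i\<in>S \<union> U'. z i = 1) \<and> (\<forall>i\<in>T \<union> (U - U'). z i = 0)) :: real)"
  proof -
    have U'eq: "(\<forall>i\<in>S \<union> U'. z i = 1) \<and> (\<forall>i\<in>T \<union> (U - U'). z i = 0) \<longleftrightarrow>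
        ((\<forall>i\<in>S. z i = 1) \<and> (\<forall>i\<in>T. z i = 0)) \<and> U' = U1" if "U' \<subseteq> U" for U'
    proof
      assume z': "(\<forall>i\<in>S \<union> U'. z i = 1) \<and> (\<forall>i\<in>T \<union> (U - U'). z i = 0)"
      have "x \<in> U' \<longleftrightarrow> x \<in> U1" for x
        using that z' by (cases "x \<in> U'") (auto simp: U1_def)
      then show "((\<forall>i\<in>S. z i = 1) \<and> (\<forall>i\<in>T. z i = 0)) \<and> U' = U1" using z' by blast
    next
      assume "((\<forall>i\<in>S. z i = 1) \<and> (\<forall>i\<in>T. z i = 0)) \<and> U' = U1"
      then show "(\<forall>i\<in>S \<union> U'. z i = 1) \<and> (\<forall>i\<in>T \<union> (U - U'). z i = 0)"
        using zU by (auto simp: U1_def)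
    qed
    have "(\<Sum>U'\<in>{U'. U' \<subseteq> U \<and> card U' \<ge> r}.
            of_bool ((\<forall>i\<in>S \<union> U'. z i = 1) \<and> (\<forall>i\<in>T \<union> (U - U'). z i = 0)) :: real)
        = (\<Sum>U'\<in>{U'. U' \<subseteq> U \<and> card U' \<ge> r}.
            if U' = U1 then of_bool ((\<forall>i\<in>S. z i = 1) \<and> (\<forall>i\<in>T. z i = 0)) else 0)"
    proof (rule sum.cong)
      fix U' assume "U' \<in> {U'. U' \<subseteq> U \<and> card U' \<ge> r}"
      then show "of_bool ((\<forall>i\<in>S \<union> U'. z i = 1) \<and> (\<forall>i\<in>T \<union> (U - U'). z i = 0))
        = (if U' = U1 then of_bool ((\<forall>i\<in>S. z i = 1) \<and> (\<forall>i\<in>T. z i = 0)) else 0 :: real)"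
        using U'eq[of U'] by simp
    qed simp
    also have "\<dots> = (if U1 \<subseteq> U \<and> r \<le> card U1
        then of_bool ((\<forall>i\<in>S. z i = 1) \<and> (\<forall>i\<in>T. z i = 0)) else 0)"
      using finU by (subst sum.delta) auto
    finally show ?thesis by (auto simp: U1_def)
  qed
  show ?thesis
    unfolding column_cond3_def Let_def
  proof (intro conjI ballI)
    show "(real (card U) - (real r - 1)) * of_bool (z \<in> fix_at C S 1 \<inter> fix_at C T 0 \<inter> fewer_than C U r)
        \<le> (\<Sum>i\<in>U. of_bool (z \<in> fix_at C {i} 0))"
      using c3 by (simp only: Int_iff fx fewer conj_assoc ball_simps simp_thms)
    show "of_bool (z \<in> fix_at C S 1 \<inter> fix_at C T 0 \<inter> fewer_than C U r)
        = of_bool (z \<in> fix_at C S 1 \<inter> fix_at C T 0) - (\<Sum>U'\<in>{U'. U' \<subseteq> U \<and> r \<le> card U'}.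
            of_bool (z \<in> fix_at C (S \<union> U') 1 \<inter> fix_at C (T \<union> (U - U')) 0) :: real)"
      using c4 by (simp only: Int_iff fx fewer conj_assoc)
  qed (auto simp: fx)
qed

text \<open>The conditions are linear and homogeneous in the column, the entry at
  \<open>zero_one C\<close> playing the part of the constant 1. The shape \<open>c * y + y'\<close>
  fits induction over a finite set of points.\<close>

lemma column_cond2_combine:
  assumes "0 \<le> c" "column_cond2 C y S T" "column_cond2 C y' S T"
  shows "column_cond2 C (\<lambda>\<alpha>. c * y \<alpha> + y' \<alpha>) S T"
proof -
  have mono: "a \<le> b \<Longrightarrow> a' \<le> b' \<Longrightarrow> c * a + a' \<le> c * b + b'" for a b a' b' :: real
    using assms(1) by (intro add_mono mult_left_mono)
  note y = assms(2,3)[unfolded column_cond2_def Let_def]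
  show ?thesis
    unfolding column_cond2_def Let_def
  proof (intro conjI ballI)
    fix i assume "i \<in> S"
    then show "c * y (fix_at C S 1 \<inter> fix_at C T 0) + y' (fix_at C S 1 \<inter> fix_at C T 0)
        \<le> c * y (fix_at C {i} 1) + y' (fix_at C {i} 1)"
      using y by (intro mono) auto
  next
    fix i assume i: "i \<in> T"
    then show "c * y (fix_at C S 1 \<inter> fix_at C T 0) + y' (fix_at C S 1 \<inter> fix_at C T 0)
        \<le> c * y (fix_at C {i} 0) + y' (fix_at C {i} 0)"
      using y by (intro mono) auto
    have "y (fix_at C S 1 \<inter> fix_at C (T - {i}) 0)
        = y (fix_at C S 1 \<inter> fix_at C T 0) + y (fix_at C (S \<union> {i}) 1 \<inter> fix_at C (T - {i}) 0)"
      "y' (fix_at C S 1 \<inter> fix_at C (T - {i}) 0)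
        = y' (fix_at C S 1 \<inter> fix_at C T 0) + y' (fix_at C (S \<union> {i}) 1 \<inter> fix_at C (T - {i}) 0)"
      using y i by simp_all
    then show "c * y (fix_at C S 1 \<inter> fix_at C T 0) + y' (fix_at C S 1 \<inter> fix_at C T 0)
        + (c * y (fix_at C (S \<union> {i}) 1 \<inter> fix_at C (T - {i}) 0)
          + y' (fix_at C (S \<union> {i}) 1 \<inter> fix_at C (T - {i}) 0))
        = c * y (fix_at C S 1 \<inter> fix_at C (T - {i}) 0) + y' (fix_at C S 1 \<inter> fix_at C (T - {i}) 0)"
      by (simp only: distrib_left)
  next
    have "c * ((\<Sum>i\<in>S. y (fix_at C {i} 1)) + (\<Sum>i\<in>T. y (fix_at C {i} 0)) - y (fix_at C S 1 \<inter> fix_at C T 0))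
        + ((\<Sum>i\<in>S. y' (fix_at C {i} 1)) + (\<Sum>i\<in>T. y' (fix_at C {i} 0)) - y' (fix_at C S 1 \<inter> fix_at C T 0))
        \<le> c * ((real (card S) + real (card T) - 1) * y (zero_one C))
          + (real (card S) + real (card T) - 1) * y' (zero_one C)"
      using y by (intro mono) auto
    then show "(\<Sum>i\<in>S. c * y (fix_at C {i} 1) + y' (fix_at C {i} 1))
        + (\<Sum>i\<in>T. c * y (fix_at C {i} 0) + y' (fix_at C {i} 0))
        - (c * y (fix_at C S 1 \<inter> fix_at C T 0) + y' (fix_at C S 1 \<inter> fix_at C T 0))
        \<le> (real (card S) + real (card T) - 1) * (c * y (zero_one C) + y' (zero_one C))"
      by (simp add: sum.distrib sum_distrib_left algebra_simps)
  qed
qed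

lemma column_cond3_combine:
  assumes "0 \<le> c" "column_cond3 C y S T U r" "column_cond3 C y' S T U r"
  shows "column_cond3 C (\<lambda>\<alpha>. c * y \<alpha> + y' \<alpha>) S T U r"
proof -
  have mono: "a \<le> b \<Longrightarrow> a' \<le> b' \<Longrightarrow> c * a + a' \<le> c * b + b'" for a b a' b' :: real
    using assms(1) by (intro add_mono mult_left_mono)
  let ?a = "fix_at C S 1 \<inter> fix_at C T 0 \<inter> fewer_than C U r"
  let ?v = "\<lambda>y. y (fix_at C S 1 \<inter> fix_at C T 0) - (\<Sum>U'\<in>{U'. U' \<subseteq> U \<and> card U' \<ge> r}.
    y (fix_at C (S \<union> U') 1 \<inter> fix_at C (T \<union> (U - U')) 0)) :: real"
  note y = assms(2,3)[unfolded column_cond3_def Let_def]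
  show ?thesis
    unfolding column_cond3_def Let_def
  proof (intro conjI ballI)
    fix i assume "i \<in> S"
    then show "c * y ?a + y' ?a \<le> c * y (fix_at C {i} 1) + y' (fix_at C {i} 1)"
      using y by (intro mono) auto
  next
    fix i assume "i \<in> T"
    then show "c * y ?a + y' ?a \<le> c * y (fix_at C {i} 0) + y' (fix_at C {i} 0)"
      using y by (intro mono) auto
  next
    have "c * ((real (card U) - (real r - 1)) * y ?a) + (real (card U) - (real r - 1)) * y' ?a
      \<le> c * (\<Sum>i\<in>U. y (fix_at C {i} 0)) + (\<Sum>i\<in>U. y' (fix_at C {i} 0))"
      using y by (intro mono) auto
    then show "(real (card U) - (real r - 1)) * (c * y ?a + y' ?a)
        \<le> (\<Sum>i\<in>U. c * y (fix_at C {i} 0) + y' (fix_at C {i} 0))"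
      by (simp add: sum.distrib sum_distrib_left algebra_simps)
  next
    have "y ?a = ?v y" "y' ?a = ?v y'" using y by blast+
    then have "c * y ?a + y' ?a = c * ?v y + ?v y'" by (simp only:)
    then show "c * y ?a + y' ?a = ?v (\<lambda>\<alpha>. c * y \<alpha> + y' \<alpha>)"
      by (simp add: sum.distrib sum_distrib_left algebra_simps)
  qed
qed

lemma column_cond_sum:
  assumes L: "packing_system L" and Z: "finite Z" "Z \<subseteq> polytope_of L \<inter> zero_one (cols L)"
    and \<mu>: "\<And>z. z \<in> Z \<Longrightarrow> 0 \<le> \<mu> z"
  shows "column_cond L k (\<lambda>\<alpha>. \<Sum>z\<in>Z. \<mu> z * of_bool (z \<in> \<alpha>))"
proof -
  let ?C = "cols L"
  let ?y = "\<lambda>Z \<alpha>. \<Sum>z\<in>Z. \<mu> z * of_bool (z \<in> \<alpha>)"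
  have C: "finite ?C" using L by (simp add: packing_system_def)
  have Z01: "z \<in> zero_one ?C" if "z \<in> Z" for z using Z that by blast
  have cond2: "column_cond2 ?C (?y Z) S T" if "S \<subseteq> ?C" "T \<subseteq> ?C" for S T
    using Z(1) Z01 \<mu>
  proof (induction Z rule: finite_induct)
    case empty
    then show ?case by (simp add: column_cond2_def)
  next
    case (insert z Z)
    show ?case
      unfolding sum.insert[OF insert.hyps(1,2)]
      by (rule column_cond2_combine[of "\<mu> z" ?C "\<lambda>\<alpha>. of_bool (z \<in> \<alpha>)" S T "?y Z"])
        (use insert column_cond2_point[OF C _ that, of z] in blast)+
  qed
  have cond3: "column_cond3 ?C (?y Z) S T U r"
    if "S \<subseteq> ?C" "T \<subseteq> ?C" "U \<subseteq> ?C" "S \<inter> T = {}" "S \<inter> U = {}" "T \<inter> U = {}" for S T U r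
    using Z(1) Z01 \<mu>
  proof (induction Z rule: finite_induct)
    case empty
    then show ?case by (simp add: column_cond3_def)
  next
    case (insert z Z)
    show ?case
      unfolding sum.insert[OF insert.hyps(1,2)]
      by (rule column_cond3_combine[of "\<mu> z" ?C "\<lambda>\<alpha>. of_bool (z \<in> \<alpha>)" S T U r "?y Z"])
        (use insert column_cond3_point[OF C _ that, of z r] in blast)+
  qed
  define l where "l = (\<Sum>z\<in>Z. \<mu> z)"
  have l: "?y Z (zero_one ?C) = l" unfolding l_def using Z01 by (intro sum.cong) auto
  have l0: "0 \<le> l" using \<mu> by (simp add: l_def sum_nonneg)
  have fx: "z \<in> fix_at ?C {i} t \<longleftrightarrow> z i = t" if "z \<in> Z" for z i t using Z01[OF that] by (simp add: fix_at_def)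
  have relax: "obstruction_relax L k = {x. (\<forall>i\<in>?C. 0 \<le> x i \<and> x i \<le> 1) \<and> (\<forall>i. i \<notin> ?C \<longrightarrow> x i = 0) \<and>
      (\<forall>i\<in>rows L. (\<Sum>j\<in>?C. coeff L i j * x j) \<le> rhs L i) \<and>
      (\<forall>Q\<in>small_obstructions L k. (\<Sum>i\<in>Q. x i) \<le> real (card Q) - 1)}"
    by (auto simp: obstruction_relax_def polytope_of_def unit_cube_def)
  have subC: "Q \<subseteq> ?C" "finite Q" if "Q \<in> small_obstructions L k" for Q
    using that C by (auto simp: small_obstructions_def row_support_def intro: finite_subset)
  have Zrelax: "z \<in> obstruction_relax L k" if z: "z \<in> Z" for z
  proof -
    have "(\<Sum>i\<in>Q. z i) \<le> real (card Q) - 1" if Q: "Q \<in> small_obstructions L k" for Q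
    proof -
      obtain i where i: "i \<in> rows L" "(\<Sum>j\<in>Q. coeff L i j) > rhs L i"
        using Q by (auto simp: small_obstructions_def)
      \<comment> \<open>Otherwise \<open>z\<close> would violate the row that makes \<open>Q\<close>
        an obstruction.\<close>
      have "\<exists>j\<in>Q. z j \<noteq> 1"
      proof (rule ccontr)
        assume "\<not> ?thesis"
        then have "(\<Sum>j\<in>Q. coeff L i j) = (\<Sum>j\<in>Q. coeff L i j * z j)" by simp
        also have "\<dots> \<le> (\<Sum>j\<in>?C. coeff L i j * z j)"
          using subC[OF Q] C L i(1) Z01[OF z]
          by (intro sum_mono2) (fastforce simp: packing_system_def zero_one_def)+
        also have "\<dots> \<le> rhs L i" using Z z i(1) by (auto simp: polytope_of_def)
        finally show False using i(2) by simp
      qed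
      then obtain j where j: "j \<in> Q" "z j \<noteq> 1" by blast
      have "(\<Sum>i\<in>Q. z i) = (\<Sum>i\<in>Q. of_bool (z i = 1))"
        using subC[OF Q] Z01[OF z] by (intro sum.cong) (auto simp: zero_one_def)
      then show ?thesis using sum_of_bool_le_card_minus_1[OF subC(2)[OF Q] j(1), of "\<lambda>i. z i = 1"] j(2) by simp
    qed
    then show ?thesis using Z z by (auto simp: obstruction_relax_def)
  qed
  have "hat_col ?C (?y Z) \<in> homog_cone (obstruction_relax L k)"
  proof (cases "l = 0")
    case True
    then have "\<mu> z = 0" if "z \<in> Z" for z using that \<mu> Z(1) by (simp add: l_def sum_nonneg_eq_0_iff)
    then have "hat_col ?C (?y Z) = (0, 0 *\<^sub>R (\<lambda>_. 0))" by (simp add: hat_col_def scaleR_fun_def fun_eq_iff)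
    \<comment> \<open>A column of mass 0 gives the apex of the cone, which takes a point of the
      relaxation. The origin is one, as right-hand sides are positive and obstructions
      nonempty.\<close>
    moreover have "(\<lambda>_. 0) \<in> obstruction_relax L k"
    proof -
      have "1 \<le> card Q" if Q: "Q \<in> small_obstructions L k" for Q
      proof -
        obtain i where i: "i \<in> rows L" "(\<Sum>j\<in>Q. coeff L i j) > rhs L i"
          using Q by (auto simp: small_obstructions_def)
        then have "Q \<noteq> {}" using L by (force simp: packing_system_def)
        then show ?thesis using subC[OF Q] by (simp add: Suc_leI card_gt_0_iff)
      qed
      then show ?thesis using L by (auto simp: relax packing_system_def intro: less_imp_le)
    qed
    ultimately show ?thesis unfolding homog_cone_def by fastforce
  next
    case False
    then have lpos: "l > 0" using l0 by simp
    define x where "x = (\<lambda>i. (\<Sum>z\<in>Z. \<mu> z * z i) / l)"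
    have avg: "(\<Sum>i\<in>A. c i * x i) \<le> b" if "\<And>z. z \<in> Z \<Longrightarrow> (\<Sum>i\<in>A. c i * z i) \<le> b" for A c b
    proof -
      have "(\<Sum>i\<in>A. c i * x i) = (\<Sum>i\<in>A. \<Sum>z\<in>Z. \<mu> z * (c i * z i)) / l"
        by (simp add: x_def sum_divide_distrib sum_distrib_left mult_ac)
      also have "(\<Sum>i\<in>A. \<Sum>z\<in>Z. \<mu> z * (c i * z i)) = (\<Sum>z\<in>Z. \<mu> z * (\<Sum>i\<in>A. c i * z i))"
        by (subst sum.swap) (simp add: sum_distrib_left)
      also have "\<dots> \<le> (\<Sum>z\<in>Z. \<mu> z * b)" using that \<mu> by (intro sum_mono mult_left_mono) auto
      also have "\<dots> = b * l" by (simp add: l_def sum_distrib_left mult.commute)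
      finally show ?thesis using lpos by (simp add: divide_right_mono)
    qed
    have "x \<in> obstruction_relax L k"
      unfolding relax mem_Collect_eq
    proof (intro conjI ballI allI impI)
      fix i assume i: "i \<in> ?C"
      show "0 \<le> x i"
        using avg[of "\<lambda>_. -1" "{i}" 0] Zrelax i by (simp add: relax)
      show "x i \<le> 1"
        using avg[of "\<lambda>_. 1" "{i}" 1] Zrelax i by (simp add: relax)
    next
      fix i assume "i \<notin> ?C"
      then have "\<mu> z * z i = 0" if "z \<in> Z" for z using Z01[OF that] by (simp add: zero_one_def)
      then have "(\<Sum>z\<in>Z. \<mu> z * z i) = 0" by (intro sum.neutral) blast
      then show "x i = 0" by (simp add: x_def)
    next
      fix i assume "i \<in> rows L"
      then show "(\<Sum>j\<in>?C. coeff L i j * x j) \<le> rhs L i"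
        using Zrelax by (intro avg) (auto simp: relax)
    next
      fix Q assume "Q \<in> small_obstructions L k"
      then show "(\<Sum>i\<in>Q. x i) \<le> real (card Q) - 1"
        using Zrelax avg[of "\<lambda>_. 1" Q "real (card Q) - 1"] by (simp add: relax)
    qed
    moreover have "hat_col ?C (?y Z) = (l, l *\<^sub>R x)"
    proof -
      have "(if i \<in> ?C then ?y Z (fix_at ?C {i} 1) else 0) = l * x i" for i
      proof -
        have "l * x i = (\<Sum>z\<in>Z. \<mu> z * z i)" using False by (simp add: x_def)
        also have "\<dots> = (if i \<in> ?C then ?y Z (fix_at ?C {i} 1) else 0)"
        proof (cases "i \<in> ?C")
          case True
          have "(\<Sum>z\<in>Z. \<mu> z * z i) = ?y Z (fix_at ?C {i} 1)"
            using fx Z01 True by (intro sum.cong) (force simp: zero_one_def)+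
          then show ?thesis using True by simp
        next
          case False
          then have "\<mu> z * z i = 0" if "z \<in> Z" for z using Z01[OF that] by (simp add: zero_one_def)
          then have "(\<Sum>z\<in>Z. \<mu> z * z i) = 0" by (intro sum.neutral) blast
          then show ?thesis using False by simp
        qed
        finally show ?thesis by simp
      qed
      then show ?thesis using l by (simp add: hat_col_def scaleR_fun_def)
    qed
    ultimately show ?thesis using l0 unfolding homog_cone_def by blast
  qed
  moreover have "?y Z (fix_at ?C {i} 1) + ?y Z (fix_at ?C {i} 0) = l" if "i \<in> ?C" for i
    unfolding l_def sum.distrib[symmetric]
    using fx Z01 that by (intro sum.cong) (force simp: zero_one_def)+
  moreover have "0 \<le> ?y Z \<alpha>" "?y Z \<alpha> \<le> l" for \<alpha>
    unfolding l_def using \<mu> by (auto intro!: sum_nonneg sum_mono simp: of_bool_def)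
  ultimately show ?thesis unfolding column_cond_def using cond2 cond3 by (simp add: l)
qed

text \<open>For a convex combination of integer points, the entry at \<open>\<alpha>\<close> and
  \<open>\<beta>\<close> is the probability of \<open>\<alpha> \<inter> \<beta>\<close>; it depends
  on the intersection only, and the matrix is a Gram matrix.\<close>

theorem integer_hull_subset_bz_plus:
  assumes L: "packing_system L"
  shows "integer_hull (cols L) (polytope_of L) \<subseteq> bz_plus k L"
proof
  let ?C = "cols L"
  define Z where "Z = polytope_of L \<inter> zero_one ?C"
  have C: "finite ?C" using L by (simp add: packing_system_def)
  have finZ: "finite Z" using finite_zero_one[OF C] by (simp add: Z_def)
  fix x assume "x \<in> integer_hull ?C (polytope_of L)"
  then have "x \<in> convex hull Z" by (simp add: integer_hull_def Z_def)
  then obtain u where u: "\<And>z. z \<in> Z \<Longrightarrow> 0 \<le> u z" "sum u Z = 1" "(\<Sum>z\<in>Z. u z *\<^sub>R z) = x"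
    unfolding convex_hull_finite[OF finZ] by blast
  have xi: "x i = (\<Sum>z\<in>Z. u z * z i)" for i
  proof -
    have "(\<Sum>z\<in>Z. u z *\<^sub>R z) i = (\<Sum>z\<in>Z. u z * z i)"
      using finZ by (induction Z rule: finite_induct) (auto simp: scaleR_fun_def)
    then show ?thesis using u(3) by simp
  qed
  \<comment> \<open>Grouped so that each column is a combination of points with nonnegative weights,
    as \<open>column_cond_sum\<close> expects.\<close>
  define Y where "Y = (\<lambda>\<alpha> \<beta>. \<Sum>z\<in>Z. (u z * of_bool (z \<in> \<beta>)) * of_bool (z \<in> \<alpha>))"
  have Y: "Y \<alpha> \<beta> = (\<Sum>z\<in>Z. u z * of_bool (z \<in> \<alpha> \<inter> \<beta>))" for \<alpha> \<beta>
    unfolding Y_def by (rule sum.cong) auto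
  have Z01: "z \<in> zero_one ?C" if "z \<in> Z" for z using that by (simp add: Z_def)
  have "Y \<in> bz_matrices L k"
    unfolding bz_matrices_def mem_Collect_eq
  proof (intro conjI ballI impI)
    show "sym_on (bz_index L k) Y" by (simp add: sym_on_def Y Int_commute)
    show "psd_on (bz_index L k) Y"
      unfolding psd_on_def
    proof
      fix c
      have "(\<Sum>\<alpha>\<in>bz_index L k. \<Sum>\<beta>\<in>bz_index L k. c \<alpha> * Y \<alpha> \<beta> * c \<beta>)
          = (\<Sum>\<alpha>\<in>bz_index L k. \<Sum>\<beta>\<in>bz_index L k. \<Sum>z\<in>Z.
              u z * ((c \<alpha> * of_bool (z \<in> \<alpha>)) * (c \<beta> * of_bool (z \<in> \<beta>))))"
        by (simp add: Y_def sum_distrib_left sum_distrib_right mult_ac)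
      also have "\<dots> = (\<Sum>z\<in>Z. \<Sum>\<alpha>\<in>bz_index L k. \<Sum>\<beta>\<in>bz_index L k.
              u z * ((c \<alpha> * of_bool (z \<in> \<alpha>)) * (c \<beta> * of_bool (z \<in> \<beta>))))"
        by (simp only: sum.swap[of _ Z "bz_index L k"])
      also have "\<dots> = (\<Sum>z\<in>Z. u z * (\<Sum>\<alpha>\<in>bz_index L k. c \<alpha> * of_bool (z \<in> \<alpha>))^2)"
        unfolding power2_eq_square sum_product by (simp only: sum_distrib_left)
      also have "\<dots> \<ge> 0" using u(1) by (intro sum_nonneg mult_nonneg_nonneg) auto
      finally show "0 \<le> (\<Sum>\<alpha>\<in>bz_index L k. \<Sum>\<beta>\<in>bz_index L k. c \<alpha> * Y \<alpha> \<beta> * c \<beta>)" .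
    qed
    show "Y (zero_one ?C) (zero_one ?C) = 1"
      using u(2) Z01 by (simp add: Y)
    show "column_cond L k (\<lambda>\<alpha>. Y \<alpha> \<beta>)" for \<beta>
      unfolding Y_def by (rule column_cond_sum[OF L finZ]) (use u in \<open>auto simp: Z_def\<close>)
    show "Y \<alpha> \<beta> = 0" if "convex hull \<alpha> \<inter> convex hull \<beta> \<inter> polytope_of L = {}" for \<alpha> \<beta>
    proof -
      have "z \<notin> \<alpha> \<inter> \<beta>" if "z \<in> Z" for z
        using that \<open>convex hull \<alpha> \<inter> convex hull \<beta> \<inter> polytope_of L = {}\<close>
          hull_subset[of \<alpha> convex] hull_subset[of \<beta> convex] by (auto simp: Z_def)
      then show ?thesis by (simp add: Y del: Int_iff)
    qed
    show "Y \<alpha>1 \<beta>1 = Y \<alpha>2 \<beta>2" if "\<alpha>1 \<inter> \<beta>1 = \<alpha>2 \<inter> \<beta>2" for \<alpha>1 \<beta>1 \<alpha>2 \<beta>2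
      using that by (simp only: Y)
  qed
  moreover have "hat_col ?C (\<lambda>\<alpha>. Y \<alpha> (zero_one ?C)) = hat x"
  proof -
    have "(if i \<in> ?C then Y (fix_at ?C {i} 1) (zero_one ?C) else 0) = x i" for i
    proof (cases "i \<in> ?C")
      case True
      have "Y (fix_at ?C {i} 1) (zero_one ?C) = (\<Sum>z\<in>Z. u z * z i)"
        unfolding Y using Z01 True by (intro sum.cong) (force simp: fix_at_def zero_one_def)+
      then show ?thesis using True by (simp add: xi)
    next
      case False
      then have "u z * z i = 0" if "z \<in> Z" for z using Z01[OF that] by (simp add: zero_one_def)
      then have "(\<Sum>z\<in>Z. u z * z i) = 0" by (intro sum.neutral) blast
      then show ?thesis using False by (simp add: xi)
    qed
    moreover have "Y (zero_one ?C) (zero_one ?C) = 1"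
      using u(2) Z01 by (simp add: Y)
    ultimately show ?thesis by (simp add: hat_col_def hat_def)
  qed
  ultimately show "x \<in> bz_plus k L" unfolding bz_plus_def by blast
qed

section \<open>The matching relaxation of a complete graph\<close>

text \<open>The indicator of \<open>A\<close> lies in \<open>fix_at C B 1\<close> exactly when
  \<open>B \<subseteq> A\<close>. Injectivity lets a test vector on edge sets be moved to the matrix
  indices.\<close>

lemma fix_at_1_inj:
  assumes "S \<subseteq> C" "S' \<subseteq> C" "fix_at C S 1 = fix_at C S' 1"
  shows "S = S'"
proof -
  have "(\<lambda>i. of_bool (i \<in> A)) \<in> fix_at C B 1 \<longleftrightarrow> B \<subseteq> A" if "A \<subseteq> C" for A B
    using that by (auto simp: fix_at_def zero_one_def)
  then show ?thesis using assms by (metis order_refl subset_antisym)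
qed

lemma convex_hull_fix_at:
  fixes x :: "'c \<Rightarrow> real"
  assumes x: "x \<in> convex hull (fix_at C S t)" and i: "i \<in> S"
  shows "x i = t"
proof -
  have "convex {x :: 'c \<Rightarrow> real. x i = t}"
  proof (rule convexI)
    fix x y :: "'c \<Rightarrow> real" and u v :: real
    assume "x \<in> {x. x i = t}" "y \<in> {x. x i = t}" "u + v = 1"
    then have "(u *\<^sub>R x + v *\<^sub>R y) i = u * t + v * t" by (simp add: scaleR_fun_def)
    also have "\<dots> = (u + v) * t" by (simp only: distrib_right)
    finally have "(u *\<^sub>R x + v *\<^sub>R y) i = (u + v) * t" .
    then show "u *\<^sub>R x + v *\<^sub>R y \<in> {x. x i = t}" using \<open>u + v = 1\<close> by simp
  qed
  moreover have "fix_at C S t \<subseteq> {x. x i = t}" using i by (auto simp: fix_at_def)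
  ultimately have "convex hull (fix_at C S t) \<subseteq> {x. x i = t}" by (rule hull_minimal[rotated])
  then show ?thesis using x by blast
qed

context
  fixes V :: "'v set" and n k :: nat
  assumes V: "finite V" "card V = 2 * n + 1" and n: "1 \<le> n" and k: "1 \<le> k"
begin

private abbreviation (input) "E \<equiv> complete_edges V"
private abbreviation (input) "L \<equiv> MT V E"

definition star_edges :: "'v \<Rightarrow> 'v set set"
  where "star_edges v = {e \<in> E. v \<in> e}"

private lemma finE: "finite E" using finite_complete_edges[OF V(1)] .

text \<open>A full star is the whole support of its row, so the second size alternative holds at
  every level; two edges at \<open>v\<close> already exceed the right-hand side 1.\<close>

lemma star_small_obstruction:
  assumes v: "v \<in> V"
  shows "star_edges v \<in> small_obstructions L k"
proof -
  have "card (V - {v}) = 2 * n" using V v by simp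
  then have "2 \<le> card (V - {v})" using n by simp
  then obtain F where "F \<subseteq> V - {v}" "card F = 2" by (rule obtain_subset_with_card_n) blast
  then obtain a b where ab: "a \<in> V" "b \<in> V" "a \<noteq> v" "b \<noteq> v" "a \<noteq> b" by (auto simp: card_2_iff)
  have "{{v, a}, {v, b}} \<subseteq> star_edges v"
    using ab v by (auto simp: star_edges_def complete_edges_def)
  moreover have "finite (star_edges v)" using finE by (simp add: star_edges_def)
  ultimately have "card {{v, a}, {v, b}} \<le> card (star_edges v)" by (intro card_mono)
  moreover have "{v, a} \<noteq> {v, b}" using ab by (auto simp: doubleton_eq_iff)
  ultimately have card2: "2 \<le> card (star_edges v)" by simp
  have supp: "row_support L v = star_edges v"
    by (auto simp: row_support_def MT_def star_edges_def)
  have "(\<Sum>e\<in>star_edges v. coeff L v e) = (\<Sum>e\<in>star_edges v. 1)"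
    by (rule sum.cong) (auto simp: MT_def star_edges_def)
  then have "(\<Sum>e\<in>star_edges v. coeff L v e) > rhs L v" using card2 by (simp add: MT_def)
  then show ?thesis
    unfolding small_obstructions_def using v supp by (auto simp: MT_def intro!: bexI[of _ v])
qed

text \<open>Listing every star twice turns the pairwise intersections into the full stars.\<close>

lemma wall_of_stars:
  assumes F: "F \<subseteq> V" "F \<noteq> {}" "2 * card F \<le> k + 1"
  shows "\<exists>W\<in>walls L k. \<forall>v\<in>F. star_edges v \<subseteq> W"
proof -
  have finF: "finite F" by (rule finite_subset[OF F(1) V(1)])
  then have pos: "card F > 0" using F by (simp add: card_gt_0_iff)
  obtain h where h: "bij_betw h {0..<card F} F" using ex_bij_betw_nat_finite[OF finF] by blast
  \<comment> \<open>The indices \<open>2 * p + 1\<close> and \<open>2 * p + 2\<close> both list the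
    star of \<open>h p\<close>.\<close>
  define Q where "Q = (\<lambda>i. star_edges (h ((i - 1) div 2)))"
  define l where "l = 2 * card F"
  define W where "W = (\<Union>i\<in>{1..l}. \<Union>j\<in>{1..l} - {i}. Q i \<inter> Q j)"
  have "Q i \<in> small_obstructions L k" if "i \<in> {1..l}" for i
  proof -
    have "(i - 1) div 2 \<in> {0..<card F}" using that by (auto simp: l_def)
    then have "h ((i - 1) div 2) \<in> F" using h by (auto simp: bij_betw_def)
    then show ?thesis unfolding Q_def using F(1) by (intro star_small_obstruction) auto
  qed
  moreover have "2 \<le> l" "l \<le> k + 1" using pos F by (auto simp: l_def)
  ultimately have "W \<in> walls L k"
    unfolding walls_def W_def by (intro UnI1 CollectI exI[of _ l] exI[of _ Q]) simp
  moreover have "star_edges v \<subseteq> W" if v: "v \<in> F" for v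
  proof -
    obtain p where p: "p < card F" "h p = v"
      using v bij_betw_imp_surj_on[OF h] by (metis atLeastLessThan_iff imageE)
    have "2 * p + 1 \<in> {1..l}" "2 * p + 2 \<in> {1..l} - {2 * p + 1}" using p by (auto simp: l_def)
    moreover have "Q (2 * p + 1) = star_edges v" "Q (2 * p + 2) = star_edges v"
      using p by (simp_all add: Q_def)
    ultimately show ?thesis unfolding W_def by blast
  qed
  ultimately show ?thesis by blast
qed

text \<open>Each edge lies in the star of one of its ends, so a block of
  \<open>(k + 1) div 2\<close> edges fits into one wall, and a tier has room for \<open>k\<close>
  walls.\<close>

lemma small_set_is_tier:
  assumes S: "S \<subseteq> E" "card S \<le> k * ((k + 1) div 2)"
  shows "S \<in> tiers L k"
proof -
  define c where "c = (k + 1) div 2"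
  have c: "1 \<le> c" "2 * c \<le> k + 1" using k by (auto simp: c_def)
  have finS: "finite S" using S finE finite_subset by blast
  obtain h where h: "bij_betw h {0..<card S} S" using ex_bij_betw_nat_finite[OF finS] by blast
  define I where "I = (\<lambda>j. {i. i < card S \<and> (j - 1) * c \<le> i \<and> i < (j - 1) * c + c})"
  define B where "B = (\<lambda>j. h ` I j)"
  have "\<exists>W\<in>walls L k. B j \<subseteq> W" for j
  proof -
    define p where "p = (\<lambda>e :: 'v set. SOME v. v \<in> e)"
    have BS: "B j \<subseteq> S" using h by (auto simp: B_def I_def bij_betw_def)
    have pe: "p e \<in> e" if "e \<in> S" for e
    proof -
      have "e \<noteq> {}" using that S by (auto simp: complete_edges_def)
      then show ?thesis unfolding p_def by (simp add: some_in_eq)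
    qed
    have sub: "I j \<subseteq> {(j - 1) * c..<(j - 1) * c + c}" by (auto simp: I_def)
    then have finI: "finite (I j)" "card (I j) \<le> c"
      using finite_subset[OF sub] card_mono[OF _ sub] by simp_all
    have "card (B j) \<le> c" unfolding B_def using card_image_le[OF finI(1), of h] finI(2) by simp
    moreover have "card (p ` B j) \<le> card (B j)" using finI(1) by (intro card_image_le) (simp add: B_def)
    ultimately have cB: "card (p ` B j) \<le> c" by simp
    have pV: "p ` B j \<subseteq> V" using BS pe S by (fastforce simp: complete_edges_def)
    obtain v0 where v0: "v0 \<in> V" using V by fastforce
    \<comment> \<open>An empty block still has to get a wall, and \<open>wall_of_stars\<close> asks
      for at least one star.\<close>
    define F where "F = (if B j = {} then {v0} else p ` B j)"
    have "F \<subseteq> V" "F \<noteq> {}" "2 * card F \<le> k + 1"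
      using pV v0 cB c by (auto simp: F_def)
    then obtain W where W: "W \<in> walls L k" "\<And>v. v \<in> F \<Longrightarrow> star_edges v \<subseteq> W"
      using wall_of_stars[of F] by blast
    have "e \<in> W" if e: "e \<in> B j" for e
    proof -
      have "e \<in> S" using e BS by blast
      then have "e \<in> star_edges (p e)" using pe S by (auto simp: star_edges_def)
      moreover have "p e \<in> F" using e by (auto simp: F_def)
      ultimately show ?thesis using W by blast
    qed
    then show ?thesis using W(1) by blast
  qed
  then obtain W where W: "\<And>j. W j \<in> walls L k" "\<And>j. B j \<subseteq> W j" by metis
  have "S \<subseteq> (\<Union>j\<in>{1..k}. W j)"
  proof
    fix e assume "e \<in> S"
    then obtain i where i: "i < card S" "e = h i"
      using bij_betw_imp_surj_on[OF h] by (metis atLeastLessThan_iff imageE)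
    have "i div c < k"
      using i S c by (intro less_mult_imp_div_less) (simp add: c_def mult.commute)
    moreover have "i \<in> I (i div c + 1)"
      using i c by (auto simp: I_def dividend_less_div_times) (metis add.commute dividend_less_div_times less_eq_Suc_le One_nat_def mult.commute)
    ultimately have "i div c + 1 \<in> {1..k}" "e \<in> B (i div c + 1)" using i by (auto simp: B_def)
    then show "e \<in> (\<Union>j\<in>{1..k}. W j)" using W(2) by blast
  qed
  then show ?thesis
    unfolding tiers_def using S W(1) by (auto simp: MT_def)
qed

lemma fix_at_in_bz_index:
  assumes S: "S \<subseteq> E" "card S \<le> k * ((k + 1) div 2)"
  shows "fix_at E S 1 \<in> bz_index L k"
proof -
  have "fix_at E S 1 = fix_at (cols L) (S - {}) 1 \<inter> fix_at (cols L) {} 0"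
    by (auto simp: fix_at_def MT_def)
  then show ?thesis
    unfolding bz_index_def using small_set_is_tier[OF S] by fastforce
qed

lemma blossom_inequality:
  assumes Y: "Y \<in> bz_matrices L k" and kn: "2 * n \<le> k * (k + 1)"
    and U: "U \<subseteq> V" "card U = 2 * m + 1"
  shows "(\<Sum>e\<in>{e \<in> E. e \<subseteq> U}. Y (fix_at E {e} 1) (zero_one E)) \<le> real m"
proof -
  define t where "t = k * ((k + 1) div 2)"
  define a where "a = (\<lambda>S. fix_at E S 1)"
  define G where "G = {e \<in> E. e \<subseteq> U}"
  define T where "T = {S. S \<subseteq> G \<and> card S \<le> t}"
  have cols: "cols L = E" by (simp add: MT_def)
  have GE: "G \<subseteq> E" "finite G" using finE by (auto simp: G_def)
  have finT: "finite T" using GE by (simp add: T_def)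
  have aT: "a S \<in> bz_index L k" if "S \<subseteq> E" "card S \<le> t" for S
    using fix_at_in_bz_index that by (simp add: a_def t_def)
  have aU: "a S \<inter> a S' = a (S \<union> S')" for S S' by (auto simp: a_def fix_at_def)
  have a0: "a {} = zero_one E" by (auto simp: a_def fix_at_def)
  have mn: "m \<le> n" using card_mono[OF V(1) U(1)] U V by simp
  \<comment> \<open>The second alternative covers \<open>k = 1\<close>, \<open>m = 1\<close> and
    \<open>k = 2\<close>, \<open>m = 3\<close>, where \<open>m + 2\<close> exceeds
    \<open>2 * t\<close>.\<close>
  have t: "m + 2 \<le> 2 * t \<or> (odd m \<and> m + 1 \<le> 2 * t)"
  proof -
    consider "k = 1" | "k = 2" | "3 \<le> k" using k by linarith
    then show ?thesis
    proof cases
      case 1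
      then have "m = 0 \<or> m = 1" using kn mn by auto
      then show ?thesis using 1 by (auto simp: t_def)
    next
      case 2
      then have "m \<le> 3" using kn mn by auto
      then consider "m \<le> 2" | "m = 3" by linarith
      then show ?thesis using 2 by cases (auto simp: t_def)
    next
      case 3
      have "k \<le> 2 * ((k + 1) div 2)" by simp
      then have "k * k \<le> k * (2 * ((k + 1) div 2))" by (rule mult_le_mono2)
      then have "k * k \<le> 2 * t" by (simp add: t_def)
      moreover have "3 * k \<le> k * k" using 3 by simp
      moreover have "2 * m \<le> k * k + k" using kn mn by (simp add: algebra_simps)
      ultimately show ?thesis using 3 by linarith
    qed
  qed
  define N where "N = (if odd m then m else m + 1)"
  have N: "odd N" "m \<le> N" "N + 1 \<le> 2 * t" using t by (auto simp: N_def)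
  have "1 \<le> t" using N(3) by (cases t) auto
  \<comment> \<open>The moment of \<open>R\<close> is any entry whose two edge sets have union
    \<open>R\<close>; equality of entries with equal intersections makes the choice
    immaterial.\<close>
  define y where "y = (\<lambda>R. SOME r. \<exists>S S'. S \<subseteq> E \<and> card S \<le> t \<and> S' \<subseteq> E \<and> card S' \<le> t \<and> S \<union> S' = R \<and> r = Y (a S) (a S'))"
  have consistent: "Y \<alpha>1 \<beta>1 = Y \<alpha>2 \<beta>2"
    if "\<alpha>1 \<in> bz_index L k" "\<beta>1 \<in> bz_index L k" "\<alpha>2 \<in> bz_index L k" "\<beta>2 \<in> bz_index L k"
      "\<alpha>1 \<inter> \<beta>1 = \<alpha>2 \<inter> \<beta>2" for \<alpha>1 \<beta>1 \<alpha>2 \<beta>2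
    using Y that unfolding bz_matrices_def by blast
  have y: "y (S \<union> S') = Y (a S) (a S')" if S: "S \<subseteq> E" "card S \<le> t" "S' \<subseteq> E" "card S' \<le> t" for S S'
  proof -
    let ?P = "\<lambda>r. \<exists>S1 S2. S1 \<subseteq> E \<and> card S1 \<le> t \<and> S2 \<subseteq> E \<and> card S2 \<le> t \<and> S1 \<union> S2 = S \<union> S' \<and> r = Y (a S1) (a S2)"
    have "?P (Y (a S) (a S'))" using S by blast
    then have "?P (y (S \<union> S'))" unfolding y_def by (rule someI)
    then obtain S1 S2 where S12: "S1 \<subseteq> E" "card S1 \<le> t" "S2 \<subseteq> E" "card S2 \<le> t" "S1 \<union> S2 = S \<union> S'"
      "y (S \<union> S') = Y (a S1) (a S2)" by blast
    have "a S1 \<inter> a S2 = a S \<inter> a S'" by (simp only: aU S12(5))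
    then show ?thesis using consistent[of "a S1" "a S2" "a S" "a S'"] aT S S12 by simp
  qed
  have "(\<Sum>e\<in>G. y {e}) \<le> real m"
  proof (rule moment_cardinality_bound[OF GE(2) _ _ _ N])
    fix c :: "'v set set \<Rightarrow> real"
    have inj: "inj_on a T"
    proof (rule inj_onI)
      fix S S' assume "S \<in> T" "S' \<in> T" "a S = a S'"
      then show "S = S'" using GE(1) by (intro fix_at_1_inj[of _ E]) (auto simp: a_def T_def)
    qed
    define d where "d = (\<lambda>\<alpha>. if \<alpha> \<in> a ` T then c (the_inv_into T a \<alpha>) else 0)"
    have da: "d (a S) = c S" if "S \<in> T" for S using that inj by (simp add: d_def the_inv_into_f_f)
    have sub: "a ` T \<subseteq> bz_index L k" using aT GE by (auto simp: T_def)
    have finN: "finite (bz_index L k)"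
    proof (rule finite_subset)
      show "bz_index L k \<subseteq> Pow (zero_one E)"
        by (auto simp: bz_index_def fix_at_def cols)
      show "finite (Pow (zero_one E))" using finite_zero_one[OF finE] by simp
    qed
    have "0 \<le> (\<Sum>\<alpha>\<in>bz_index L k. \<Sum>\<beta>\<in>bz_index L k. d \<alpha> * Y \<alpha> \<beta> * d \<beta>)"
      using Y unfolding bz_matrices_def psd_on_def by blast
    also have "\<dots> = (\<Sum>\<alpha>\<in>a ` T. \<Sum>\<beta>\<in>bz_index L k. d \<alpha> * Y \<alpha> \<beta> * d \<beta>)"
      using finN sub by (intro sum.mono_neutral_right) (auto simp: d_def)
    also have "\<dots> = (\<Sum>\<alpha>\<in>a ` T. \<Sum>\<beta>\<in>a ` T. d \<alpha> * Y \<alpha> \<beta> * d \<beta>)"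
      using finN sub by (intro sum.cong sum.mono_neutral_right) (auto simp: d_def)
    also have "\<dots> = (\<Sum>S\<in>T. \<Sum>S'\<in>T. d (a S) * Y (a S) (a S') * d (a S'))"
      by (simp add: sum.reindex[OF inj])
    also have "\<dots> = (\<Sum>S\<in>T. \<Sum>S'\<in>T. c S * y (S \<union> S') * c S')"
    proof (intro sum.cong)
      fix S S' assume "S \<in> T" "S' \<in> T"
      then show "d (a S) * Y (a S) (a S') * d (a S') = c S * y (S \<union> S') * c S'"
        using y[of S S'] da[of S] da[of S'] GE by (simp add: T_def subset_trans[of _ G])
    qed simp_all
    finally show "0 \<le> (\<Sum>S\<in>{S. S \<subseteq> G \<and> card S \<le> t}. \<Sum>S'\<in>{S. S \<subseteq> G \<and> card S \<le> t}. c S * y (S \<union> S') * c S')"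
      by (simp only: T_def)
  next
    have "Y (zero_one E) (zero_one E) = 1" using Y by (simp add: bz_matrices_def cols)
    then show "y {} = 1" using y[of "{}" "{}"] a0 by simp
  next
    fix R assume R: "R \<subseteq> G" "m < card R" "card R \<le> 2 * t"
    \<comment> \<open>A matching covers twice as many vertices as it has edges, so more than
      \<open>m\<close> edges do not fit into \<open>U\<close>.\<close>
    have "R \<notin> matchings E"
    proof
      assume M: "R \<in> matchings E"
      have "\<Union>R \<subseteq> U" using R by (auto simp: G_def)
      then have "card (\<Union>R) \<le> card U" using U V by (meson card_mono finite_subset)
      then show False using card_matching_vertices[OF V(1) subset_refl M] U R by simp
    qed
    then obtain e e' v where ee: "e \<in> R" "e' \<in> R" "e \<noteq> e'" "v \<in> e" "v \<in> e'"
      using R GE by (auto simp: matchings_def pairwise_def disjnt_def)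
    have eE: "e \<in> E" "e' \<in> E" using ee R GE by auto
    then have vV: "v \<in> V" using ee by (auto simp: complete_edges_def)
    \<comment> \<open>Two parts of size at most \<open>t\<close> make the moment of \<open>R\<close>
      an entry of the matrix.\<close>
    have "min t (card R) \<le> card R" by simp
    then obtain S where S: "S \<subseteq> R" "card S = min t (card R)" by (rule obtain_subset_with_card_n) blast
    have "finite R" using R GE finite_subset by blast
    then have "card (R - S) = card R - min t (card R)" using S by (simp add: card_Diff_subset finite_subset)
    then have St: "card S \<le> t" "card (R - S) \<le> t" using S R by auto
    have SE: "S \<subseteq> E" "R - S \<subseteq> E" using S R GE by auto
    have RS: "S \<union> (R - S) = R" using S by auto
    \<comment> \<open>Each hull fixes its coordinates to 1, so a common point would be 1 at two
      edges through \<open>v\<close>, against the row of \<open>v\<close>.\<close>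
    have "convex hull (a S) \<inter> convex hull (a (R - S)) \<inter> polytope_of L = {}"
    proof (rule ccontr)
      assume "\<not> ?thesis"
      then obtain x where x: "x \<in> convex hull (a S)" "x \<in> convex hull (a (R - S))" "x \<in> polytope_of L"
        by blast
      have x1: "x f = 1" if "f \<in> R" for f
        using convex_hull_fix_at[OF x(1)[unfolded a_def], of f] convex_hull_fix_at[OF x(2)[unfolded a_def], of f] that
        by (cases "f \<in> S") auto
      have x0: "0 \<le> x f" if "f \<in> E" for f
        using x(3) that by (auto simp: polytope_of_def unit_cube_def cols)
      have "(\<Sum>f\<in>{e, e'}. x f) \<le> (\<Sum>f\<in>{f \<in> E. v \<in> f}. x f)"
        using finE x0 ee eE by (intro sum_mono2) auto
      also have "\<dots> = (\<Sum>f\<in>E. (if v \<in> f then 1 else 0) * x f)"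
        using finE by (intro sum.mono_neutral_cong_left) auto
      also have "\<dots> \<le> 1" using x(3) vV by (auto simp: polytope_of_def MT_def)
      finally show False using x1 ee by simp
    qed
    then have "Y (a S) (a (R - S)) = 0"
      using Y aT[OF SE(1) St(1)] aT[OF SE(2) St(2)] unfolding bz_matrices_def by blast
    then show "y R = 0" using y[OF SE(1) St(1) SE(2) St(2)] RS by simp
  qed
  moreover have "y {e} = Y (fix_at E {e} 1) (zero_one E)" if "e \<in> G" for e
  proof -
    have "y ({e} \<union> {}) = Y (a {e}) (a {})"
      by (rule y) (use that GE \<open>1 \<le> t\<close> in auto)
    then show ?thesis unfolding a0 by (simp add: a_def)
  qed
  ultimately show ?thesis by (simp add: G_def)
qed

lemma bz_plus_subset_integer_hull:
  assumes kn: "2 * n \<le> k * (k + 1)"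
  shows "bz_plus k L \<subseteq> integer_hull E (polytope_of L)"
proof
  have cols: "cols L = E" by (simp add: MT_def)
  fix x assume "x \<in> bz_plus k L"
  then obtain Y where Y: "Y \<in> bz_matrices L k"
    and hat: "hat_col E (\<lambda>\<alpha>. Y \<alpha> (zero_one E)) = hat x" by (auto simp: bz_plus_def cols)
  have xY: "x e = (if e \<in> E then Y (fix_at E {e} 1) (zero_one E) else 0)" for e
    using hat by (auto simp: hat_col_def hat_def)
  have "zero_one E \<in> bz_index L k"
    using fix_at_in_bz_index[of "{}"] by (simp add: fix_at_def)
  then have "column_cond L k (\<lambda>\<alpha>. Y \<alpha> (zero_one E))" using Y by (simp add: bz_matrices_def)
  then have "hat x \<in> homog_cone (obstruction_relax L k)" using hat by (simp add: column_cond_def cols)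
  \<comment> \<open>The leading coordinate 1 forces the multiplier of the cone to be 1.\<close>
  then have x: "x \<in> polytope_of L"
    by (auto simp: homog_cone_def hat_def obstruction_relax_def scaleR_fun_def)
  have "x \<in> convex hull ((\<lambda>M e. if e \<in> M then 1 else 0) ` matchings E)"
  proof (rule matching_polytope[OF V(1) subset_refl])
    show "0 \<le> x e" if "e \<in> E" for e using x that by (auto simp: polytope_of_def unit_cube_def cols)
    show "x e = 0" if "e \<notin> E" for e using xY that by simp
    show "(\<Sum>e\<in>{e \<in> E. v \<in> e}. x e) \<le> 1" if v: "v \<in> V" for v
    proof -
      have "(\<Sum>e\<in>{e \<in> E. v \<in> e}. x e) = (\<Sum>e\<in>E. (if v \<in> e then 1 else 0) * x e)"
        using finE by (intro sum.mono_neutral_cong_left) auto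
      also have "\<dots> \<le> 1" using x v by (auto simp: polytope_of_def MT_def)
      finally show ?thesis .
    qed
    show "(\<Sum>e\<in>{e \<in> E. e \<subseteq> U}. x e) \<le> (real (card U) - 1) / 2" if U: "U \<subseteq> V" "odd (card U)" for U
    proof -
      obtain m where m: "card U = 2 * m + 1" using U(2) by (rule oddE)
      have "(\<Sum>e\<in>{e \<in> E. e \<subseteq> U}. x e) = (\<Sum>e\<in>{e \<in> E. e \<subseteq> U}. Y (fix_at E {e} 1) (zero_one E))"
        by (rule sum.cong) (auto simp: xY)
      then show ?thesis using blossom_inequality[OF Y kn U(1) m] m by simp
    qed
  qed
  moreover have "(\<lambda>M e. if e \<in> M then 1 else 0) ` matchings E \<subseteq> polytope_of L \<inter> zero_one E"
  proof (rule image_subsetI)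
    fix M assume M: "M \<in> matchings E"
    have "(\<Sum>e\<in>E. (if v \<in> e then 1 else 0) * (if e \<in> M then 1 else 0 :: real)) \<le> 1" for v
    proof -
      have "(\<Sum>e\<in>E. (if v \<in> e then 1 else 0) * (if e \<in> M then 1 else 0 :: real)) = (\<Sum>e\<in>{e \<in> M. v \<in> e}. 1)"
        using finE M by (intro sum.mono_neutral_cong_right) (auto simp: matchings_def)
      moreover have "card {e \<in> M. v \<in> e} \<le> 1"
      proof -
        have "finite {e \<in> M. v \<in> e}" using M finE by (auto simp: matchings_def intro: finite_subset)
        then show ?thesis using matchings_same_edge[OF M] by (auto simp: card_le_Suc0_iff_eq)
      qed
      ultimately show ?thesis by simp
    qed
    moreover have "M \<subseteq> E" using M by (simp add: matchings_def)
    ultimately show "(\<lambda>e. if e \<in> M then 1 else 0) \<in> polytope_of L \<inter> zero_one E"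
      by (auto simp: polytope_of_def unit_cube_def zero_one_def MT_def)
  qed
  ultimately show "x \<in> integer_hull E (polytope_of L)"
    unfolding integer_hull_def using hull_mono by blast
qed

end

theorem theorem14:
  fixes n :: nat
  assumes "n \<ge> 1"
  shows "op_rank bz_plus (MT {1..2 * n + 1} (complete_edges {1..2 * n + 1}))
           \<le> enat (nat \<lceil>sqrt (2 * real n + 1 / 4) - 1 / 2\<rceil>)"
proof -
  let ?V = "{1..2 * n + 1}"
  let ?L = "MT ?V (complete_edges ?V)"
  let ?s = "sqrt (2 * real n + 1 / 4)"
  define k where "k = nat \<lceil>?s - 1 / 2\<rceil>"
  \<comment> \<open>Level 0 of the rank is the polytope itself, so \<open>k\<close> has to be
    positive for \<open>bz_plus\<close> to apply.\<close>
  have "sqrt (1 / 4) < ?s" using assms by (subst real_sqrt_less_iff) simp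
  then have "1 / 2 < ?s" by (simp add: real_sqrt_divide)
  then have k: "1 \<le> k" "?s - 1 / 2 \<le> real k"
    unfolding k_def by linarith+
  \<comment> \<open>Here \<open>(k + 1 / 2)^2 = k * (k + 1) + 1 / 4\<close>, and the quarters
    cancel.\<close>
  have "?s ^ 2 \<le> (real k + 1 / 2) ^ 2" using k assms by (intro power_mono) auto
  then have "2 * real n \<le> real k * (real k + 1)"
    by (simp add: power2_eq_square algebra_simps)
  then have "real (2 * n) \<le> real (k * (k + 1))"
    by (simp only: of_nat_mult of_nat_add of_nat_1 of_nat_numeral)
  then have kn: "2 * n \<le> k * (k + 1)" by (simp only: of_nat_le_iff)
  have V: "finite ?V" "card ?V = 2 * n + 1" by simp_all
  have cols: "cols ?L = complete_edges ?V" by (simp add: MT_def)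
  have "packing_system ?L" by (rule packing_system_MT) auto
  then have "bz_plus k ?L = integer_hull (cols ?L) (polytope_of ?L)"
    using integer_hull_subset_bz_plus[of ?L k] bz_plus_subset_integer_hull[OF V assms k(1) kn]
    unfolding cols by (intro subset_antisym) blast+
  then have "enat k \<in> {enat k | k. (if k = 0 then polytope_of ?L else bz_plus k ?L)
                       = integer_hull (cols ?L) (polytope_of ?L)}"
    using k(1) by (intro CollectI exI[of _ k]) simp
  then show ?thesis unfolding op_rank_def k_def[symmetric] by (rule Inf_lower)
qed

end
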